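(* Let $X_1,\ldots,X_n$ be i.i.d. random variables taking values in $[0,1]$ with density $f\in\Sigma(r,B,[0,1])$ where $0<r<1$. Let $C_n$ be a confidence band that is asymptotically honest with level $\alpha$ for $\Sigma(r,B,[0,1])$. Then $$\liminf_n\sup_{f\in\Sigma(r,B,[0,1])}\frac{E_f|C_n|}{r_n(r)}\ge cB^p(1-\alpha)$$ for some fixed constants $c,p>0$ that depend only on $r$.
   Context: $\Pr_f$ and $E_f$ denote the joint law of $X_1,\ldots,X_n$ and the corresponding expectation when the density is $f$. $B\ge1$ and $0<\alpha<1$. Hölder norm: fix an $S$-regular Daubechies wavelet basis of $L^2([0,1])$ (boundary-corrected), $S>r$: scaling functions $\phi_k$, $k=1,\ldots,N$, and wavelets $\psi_{lk}=2^{l/2}\psi_k(2^l\cdot)$, $l\ge J_0$, $k=1,\ldots,2^l$, with $\phi_k,\psi_k$ compactly supported and $S$ times continuously differentiable. For continuous $f$ on $[0,1]$ put $\alpha_k(f)=\int f\phi_k$, $\beta_{lk}(f)=\int f\psi_{lk}$ and $\|f\|_{r,\infty}=\max\bigl(\sup_k|\alpha_k(f)|,\ \sup_{k,l}2^{l(r+1/2)}|\beta_{lk}(f)|\bigr)$ (equivalent to the classical Hölder norm). $\Sigma(r,B,[0,1])=\{f:[0,1]\to[0,\infty)\text{ continuous},\ \int_0^1 f=1,\ \|f\|_{r,\infty}\le B\}$ and $r_n(r)=(\log n/n)^{r/(2r+1)}$. Confidence band: $C_n=C_n(X_1,\ldots,X_n)$ is a family of random intervals $\{C_n(y)=[c_n(y),c_n'(y)]\}_{y\in[0,1]}$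 with maximal diameter $|C_n|=\sup_{y\in[0,1]}|c_n'(y)-c_n(y)|$. $\{f\in C_n\}$ means $f(y)\in C_n(y)$ for all $y\in[0,1]$. $C_n$ is asymptotically honest with level $\alpha$ for a family $\mathcal P$ of densities if $\liminf_n\inf_{f\in\mathcal P}\Pr_f(f\in C_n)\ge1-\alpha$. *)

theory Defs
  imports "HOL-Analysis.Analysis" "HOL-Computational_Algebra.Polynomial"
begin

definition C_times :: "nat \<Rightarrow> (real \<Rightarrow> real) \<Rightarrow> bool" where
  "C_times S f \<longleftrightarrow>
     (\<forall>i<S. \<forall>x. (deriv ^^ i) f field_differentiable at x) \<and>
     continuous_on UNIV ((deriv ^^ S) f)"

definition L2_on :: "real set \<Rightarrow> (real \<Rightarrow> real) \<Rightarrow> bool" where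
  "L2_on A g \<longleftrightarrow>
     set_borel_measurable lborel A g \<and> set_integrable lborel A (\<lambda>x. (g x)\<^sup>2)"

definition inner_on :: "real set \<Rightarrow> (real \<Rightarrow> real) \<Rightarrow> (real \<Rightarrow> real) \<Rightarrow> real" where
  "inner_on A f g = (LINT x:A|lborel. f x * g x)"

definition L2_orthonormal_basis :: "real set \<Rightarrow> 'i set \<Rightarrow> ('i \<Rightarrow> real \<Rightarrow> real) \<Rightarrow> bool" where
  "L2_orthonormal_basis A I e \<longleftrightarrow>
     (\<forall>i\<in>I. L2_on A (e i)) \<and>
     (\<forall>i\<in>I. \<forall>j\<in>I. inner_on A (e i) (e j) = (if i = j then 1 else 0)) \<and>
     (\<forall>g \<epsilon>. L2_on A g \<longrightarrow> 0 < \<epsilon> \<longrightarrow>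
        (\<exists>F a. finite F \<and> F \<subseteq> I \<and>
           (LINT x:A|lborel. (g x - (\<Sum>i\<in>F. a i * e i x))\<^sup>2) < \<epsilon>))"

text \<open>
  Daubechies' compactly supported scaling function \<open>\<phi>\<close> and wavelet \<open>\<psi>\<close> with \<open>N\<close> vanishing
  moments, shifted so that both are supported in \<open>[1 - N, N]\<close>.  The filter \<open>h\<close> has the
  minimal length \<open>2 N\<close>; this leaves open only the choice of phase (extremal phase,
  symmlets, ...).
\<close>

definition daubechies_pair :: "nat \<Rightarrow> (real \<Rightarrow> real) \<Rightarrow> (real \<Rightarrow> real) \<Rightarrow> bool" where
  "daubechies_pair N \<phi> \<psi> \<longleftrightarrow>
     (\<exists>h :: int \<Rightarrow> real.
        (\<forall>x. \<phi> x = sqrt 2 * (\<Sum>k\<in>{1 - int N..int N}. h k * \<phi> (2 * x - of_int k))) \<and>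
        (\<forall>x. \<psi> x = sqrt 2 * (\<Sum>k\<in>{1 - int N..int N}.
                       (- 1) powi k * h (1 - k) * \<phi> (2 * x - of_int k)))) \<and>
     (\<forall>x. x \<notin> {1 - real N..real N} \<longrightarrow> \<phi> x = 0) \<and>
     (LINT x|lborel. \<phi> x) = 1 \<and>
     (\<forall>m :: int. (LINT x|lborel. \<phi> x * \<phi> (x - of_int m)) = (if m = 0 then 1 else 0)) \<and>
     (\<forall>j<N. (LINT x|lborel. x ^ j * \<psi> x) = 0)"

text \<open>
  Boundary correction of Cohen, Daubechies and Vial.  The half line \<open>H\<close> is \<open>[0, \<infinity>)\<close> at the
  left and \<open>(-\<infinity>, 0]\<close> at the right end point.  Since every polynomial of degree less than
  \<open>N\<close> is of the form \<open>\<Sum>\<^sub>m p(m) \<phi>(x - m)\<close>, with \<open>p\<close> of degree less than \<open>N\<close> and \<open>m\<close> ranging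
  over the integers, the part of this sum over those \<open>m\<close> in \<open>M\<close> whose translate meets \<open>H\<close>
  but is not an interior scaling function spans the \<open>N\<close>-dimensional space of edge scaling
  functions.
  Only the values on \<open>H\<close> of the edge functions matter.
\<close>

definition edge_space :: "nat \<Rightarrow> (real \<Rightarrow> real) \<Rightarrow> int set \<Rightarrow> (real \<Rightarrow> real) set" where
  "edge_space N \<phi> M =
     {(\<lambda>x. \<Sum>m\<in>M. poly p (of_int m) * \<phi> (x - of_int m)) | p :: real poly. degree p < N}"

definition edge_scaling ::
    "nat \<Rightarrow> (real \<Rightarrow> real) \<Rightarrow> real set \<Rightarrow> int set \<Rightarrow> (nat \<Rightarrow> real \<Rightarrow> real) \<Rightarrow> bool" where
  "edge_scaling N \<phi> H M e \<longleftrightarrow>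
     (\<forall>j<N. \<exists>g\<in>edge_space N \<phi> M. \<forall>x\<in>H. e j x = g x) \<and>
     (\<forall>g\<in>edge_space N \<phi> M. \<exists>a. \<forall>x\<in>H. g x = (\<Sum>j<N. a j * e j x))"

text \<open>
  Edge wavelets are combinations of the scaling functions of the next finer level.  That they
  are orthogonal to the coarser scaling functions and to the other wavelets is part of
  \<open>L2_orthonormal_basis\<close> in \<open>daubechies_basis\<close> below.
\<close>

definition edge_wavelet ::
    "nat \<Rightarrow> (real \<Rightarrow> real) \<Rightarrow> real set \<Rightarrow> int set \<Rightarrow> (nat \<Rightarrow> real \<Rightarrow> real) \<Rightarrow> (nat \<Rightarrow> real \<Rightarrow> real) \<Rightarrow> bool"
  where
  "edge_wavelet N \<phi> H M e d \<longleftrightarrow>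
     (\<forall>j<N. \<exists>a b. \<forall>x\<in>H.
        d j x = (\<Sum>i<N. a i * e i (2 * x)) + (\<Sum>m\<in>M. b m * \<phi> (2 * x - of_int m)))"

text \<open>
  The \<open>k\<close>-th function, \<open>1 \<le> k \<le> 2\<^sup>l\<close>, at level \<open>l\<close>: \<open>N\<close> left edge functions, \<open>2\<^sup>l - 2 N\<close>
  translates of the generator \<open>g\<close>, and \<open>N\<close> right edge functions.
\<close>

definition level_fun ::
    "nat \<Rightarrow> (real \<Rightarrow> real) \<Rightarrow> (nat \<Rightarrow> real \<Rightarrow> real) \<Rightarrow> (nat \<Rightarrow> real \<Rightarrow> real) \<Rightarrow> nat \<Rightarrow> nat \<Rightarrow> real \<Rightarrow> real"
  where
  "level_fun N g gL gR l k x = 2 powr (real l / 2) *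
     (if k \<le> N then gL (k - 1) (2 ^ l * x)
      else if k \<le> 2 ^ l - N then g (2 ^ l * x - real (k - 1))
      else gR (2 ^ l - k) (2 ^ l * (x - 1)))"

definition wavelet_index :: "nat \<Rightarrow> (nat \<times> nat) set" where
  "wavelet_index J0 = (SIGMA l:{J0..}. {1..2 ^ l})"

text \<open>
  \<open>\<Phi> k\<close> (\<open>1 \<le> k \<le> 2\<^sup>J\<^sup>0\<close>) and \<open>\<Psi> l k\<close> (\<open>l \<ge> J0\<close>, \<open>1 \<le> k \<le> 2\<^sup>l\<close>) form an \<open>S\<close>-regular
  boundary-corrected Daubechies wavelet basis of \<open>L\<^sup>2([0,1])\<close>.  The edge functions are finite
  combinations of dilated translates of \<open>\<phi>\<close>, hence inherit compact support and
  smoothness from \<open>\<phi>\<close>.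
\<close>

definition daubechies_basis ::
    "nat \<Rightarrow> nat \<Rightarrow> (nat \<Rightarrow> real \<Rightarrow> real) \<Rightarrow> (nat \<Rightarrow> nat \<Rightarrow> real \<Rightarrow> real) \<Rightarrow> bool" where
  "daubechies_basis S J0 \<Phi> \<Psi> \<longleftrightarrow>
     (\<exists>N \<phi> \<psi> \<phi>L \<phi>R \<psi>L \<psi>R.
        1 \<le> N \<and> 2 * N \<le> 2 ^ J0 \<and>
        daubechies_pair N \<phi> \<psi> \<and> C_times S \<phi> \<and> C_times S \<psi> \<and>
        edge_scaling N \<phi> {0..} {1 - int N..int N - 1} \<phi>L \<and>
        edge_scaling N \<phi> {..0} {- int N..int N - 2} \<phi>R \<and>
        edge_wavelet N \<phi> {0..} {int N..3 * int N - 2} \<phi>L \<psi>L \<and>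
        edge_wavelet N \<phi> {..0} {1 - 3 * int N..- 1 - int N} \<phi>R \<psi>R \<and>
        (\<forall>k\<in>{1..2 ^ J0}. \<forall>x\<in>{0..1}. \<Phi> k x = level_fun N \<phi> \<phi>L \<phi>R J0 k x) \<and>
        (\<forall>(l, k)\<in>wavelet_index J0. \<forall>x\<in>{0..1}. \<Psi> l k x = level_fun N \<psi> \<psi>L \<psi>R l k x)) \<and>
     L2_orthonormal_basis {0..1} ({1..2 ^ J0} <+> wavelet_index J0)
       (case_sum \<Phi> (\<lambda>(l, k). \<Psi> l k))"

definition hoelder_norm ::
    "nat \<Rightarrow> (nat \<Rightarrow> real \<Rightarrow> real) \<Rightarrow> (nat \<Rightarrow> nat \<Rightarrow> real \<Rightarrow> real) \<Rightarrow> real \<Rightarrow> (real \<Rightarrow> real) \<Rightarrow> ennreal"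
  where
  "hoelder_norm J0 \<Phi> \<Psi> r f =
     max (SUP k\<in>{1..2 ^ J0}. ennreal \<bar>LINT x:{0..1}|lborel. f x * \<Phi> k x\<bar>)
         (SUP (l, k)\<in>wavelet_index J0.
            ennreal (2 powr (real l * (r + 1 / 2)) * \<bar>LINT x:{0..1}|lborel. f x * \<Psi> l k x\<bar>))"

text \<open>Functions on \<open>[0,1]\<close> are represented by functions on the reals, whose values outside
  \<open>[0,1]\<close> are irrelevant.\<close>

definition hoelder_densities ::
    "nat \<Rightarrow> (nat \<Rightarrow> real \<Rightarrow> real) \<Rightarrow> (nat \<Rightarrow> nat \<Rightarrow> real \<Rightarrow> real) \<Rightarrow> real \<Rightarrow> real \<Rightarrow> (real \<Rightarrow> real) set"
  where
  "hoelder_densities J0 \<Phi> \<Psi> r B =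
     {f. continuous_on {0..1} f \<and> (\<forall>x\<in>{0..1}. 0 \<le> f x) \<and>
         (LINT x:{0..1}|lborel. f x) = 1 \<and>
         hoelder_norm J0 \<Phi> \<Psi> r f \<le> ennreal B}"

definition rate :: "real \<Rightarrow> nat \<Rightarrow> real" where
  "rate r n = (ln (real n) / real n) powr (r / (2 * r + 1))"

text \<open>The joint law of \<open>X\<^sub>1, \<dots>, X\<^sub>n\<close>, on the sample space \<open>[0,1]\<^sup>n\<close>.\<close>

definition sample_law :: "nat \<Rightarrow> (real \<Rightarrow> real) \<Rightarrow> (nat \<Rightarrow> real) measure" where
  "sample_law n f =
     (\<Pi>\<^sub>M i\<in>{1..n}. density (restrict_space lborel {0..1}) (\<lambda>x. ennreal (f x)))"

definition sample_space :: "nat \<Rightarrow> (nat \<Rightarrow> real) measure" where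
  "sample_space n = (\<Pi>\<^sub>M i\<in>{1..n}. restrict_space borel {0..1})"

text \<open>A band consists of the end points \<open>lo n X y\<close> and \<open>up n X y\<close> of the interval at \<open>y\<close>,
  for the sample \<open>X\<close> of size \<open>n\<close>.\<close>

type_synonym band = "nat \<Rightarrow> (nat \<Rightarrow> real) \<Rightarrow> real \<Rightarrow> real"

definition diameter_band :: "band \<Rightarrow> band \<Rightarrow> nat \<Rightarrow> (nat \<Rightarrow> real) \<Rightarrow> ennreal" where
  "diameter_band lo up n X = (SUP y\<in>{0..1}. ennreal \<bar>up n X y - lo n X y\<bar>)"

definition cover_event :: "band \<Rightarrow> band \<Rightarrow> nat \<Rightarrow> (real \<Rightarrow> real) \<Rightarrow> (nat \<Rightarrow> real) set" where
  "cover_event lo up n f =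
     {X \<in> space (sample_space n). \<forall>y\<in>{0..1}. f y \<in> {lo n X y..up n X y}}"

text \<open>Suprema and intersections over uncountably many \<open>y\<close> need not be measurable, so
  measurability of the diameter and of the coverage events is required explicitly.\<close>

definition confidence_band :: "band \<Rightarrow> band \<Rightarrow> bool" where
  "confidence_band lo up \<longleftrightarrow>
     (\<forall>n. (\<forall>y\<in>{0..1}. (\<lambda>X. lo n X y) \<in> borel_measurable (sample_space n) \<and>
                       (\<lambda>X. up n X y) \<in> borel_measurable (sample_space n)) \<and>
          diameter_band lo up n \<in> borel_measurable (sample_space n))"

definition asymptotically_honest ::
    "real \<Rightarrow> (real \<Rightarrow> real) set \<Rightarrow> band \<Rightarrow> band \<Rightarrow> bool" where
  "asymptotically_honest \<alpha> \<P> lo up \<longleftrightarrow>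
     (\<forall>n. \<forall>f\<in>\<P>. cover_event lo up n f \<in> sets (sample_space n)) \<and>
     ennreal (1 - \<alpha>) \<le>
       liminf (\<lambda>n. INF f\<in>\<P>. emeasure (sample_law n f) (cover_event lo up n f))"

end

theory Submission
  imports Defs "HOL-Library.Groups_Big_Fun" "HOL-Probability.Probability" "HOL-Real_Asymp.Real_Asymp"
begin

text \<open>
  The uniform density is perturbed by single interior wavelets of a common level \<open>l\<close>: put
  \<open>f\<^sub>i = 1 + d \<psi>\<^sub>l\<^sub>k\<close> with \<open>d = B 2\<^bsup>-l(r+1/2)\<^esup>\<close> and \<open>k = k(i)\<close> spaced so that supports are disjoint.
  These are \<open>M\<close> densities of the class, with \<open>M\<close> of order \<open>2\<^sup>l\<close>, at mutual sup-distance at least \<open>s\<close>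
  of order \<open>B 2\<^bsup>-lr\<^esup>\<close>.  On the event that the diameter of the band is below \<open>s\<close>, the band covers
  at most one \<open>f\<^sub>i\<close>.  The coverage events are then disjoint, so the likelihood ratios \<open>L\<^sub>i\<close> with
  respect to the uniform law, whose second moments are \<open>(1 + d\<^sup>2)\<^sup>n\<close>, bound the average
  over \<open>i\<close> of their probabilities by a multiple of \<open>((1 + d\<^sup>2)\<^sup>n / M)\<^bsup>1/2\<^esup>\<close>.  This tends to 0 when \<open>2\<^sup>l\<close>
  is of order \<open>(B\<^sup>2 n / log n)\<^bsup>1/(2r+1)\<^esup>\<close> with a suitable constant.  Honesty therefore forces
  the diameter to be at least \<open>s\<close> with average probability about \<open>1 - \<alpha>\<close>.  Comparing several
  perturbations with each other, rather than with the uniform density, is what makes the argument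
  work for all \<open>\<alpha> < 1\<close>, including \<open>\<alpha> \<ge> 1/2\<close>.
\<close>

subsection \<open>Constants in the span of the scaling functions\<close>

lemma integrable_continuous_compact_support:
  fixes f :: "real \<Rightarrow> real"
  assumes "continuous_on UNIV f" and "\<And>x. x \<notin> {a..b} \<Longrightarrow> f x = 0"
  shows "integrable lborel f"
proof -
  have "integrable lborel (\<lambda>x. indicator {a..b} x *\<^sub>R f x)"
    using borel_integrable_atLeastAtMost'[of a b f] assms(1) continuous_on_subset
    unfolding set_integrable_def by blast
  moreover have "(\<lambda>x. indicator {a..b} x *\<^sub>R f x) = f"
    using assms(2) by (auto simp: fun_eq_iff indicator_def)
  ultimately show ?thesis by simp
qed

lemma bounded_continuous_compact_support:
  fixes f :: "real \<Rightarrow> real"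
  assumes "continuous_on UNIV f" and "\<And>x. x \<notin> {a..b} \<Longrightarrow> f x = 0"
  obtains K where "0 < K" and "\<And>x. \<bar>f x\<bar> \<le> K"
proof -
  have "compact (f ` {a..b})"
    using assms(1) by (intro compact_continuous_image) (auto intro: continuous_on_subset)
  then obtain K where "\<forall>y\<in>f ` {a..b}. norm y \<le> K"
    using compact_imp_bounded bounded_iff by metis
  then have "\<bar>f x\<bar> \<le> max K 1" for x
    using assms(2)[of x] by (cases "x \<in> {a..b}") (auto simp: le_max_iff_disj)
  then show thesis using that[of "max K 1"] by auto
qed

lemma C_times_continuous:
  assumes "C_times S f" and "0 < S"
  shows "continuous_on UNIV f"
proof -
  have "f field_differentiable at x" for x
    using assms unfolding C_times_def by (metis funpow_0)
  then show ?thesis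
    by (simp add: continuous_at_imp_continuous_on field_differentiable_imp_continuous_at)
qed

section \<open>Refinement equation, filter sums and the partition of unity\<close>

lemma integral_dilated:
  fixes f :: "real \<Rightarrow> real"
  shows "(LINT x|lborel. f (2 * x - t)) = (LINT x|lborel. f x) / 2"
  using lborel_integral_real_affine[of 2 f "- t"] by (simp add: add.commute)

lemma integrable_dilated:
  fixes f :: "real \<Rightarrow> real"
  assumes "integrable lborel f"
  shows "integrable lborel (\<lambda>x. f (2 * x - t))"
  using lborel_integrable_real_affine[of f 2 "- t"] assms by (simp add: add.commute)

text \<open>Integrating the two refinement equations gives total sum \<open>sqrt 2\<close> for
  \<open>h\<close> and, since \<open>\<psi>\<close> has mean zero, alternating sum 0. The even and
  the odd part therefore each carry half of the total.\<close>

lemma even_odd_filter_sums: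
  fixes \<phi> \<psi> :: "real \<Rightarrow> real" and h :: "int \<Rightarrow> real"
  assumes "integrable lborel \<phi>" and "(LINT x|lborel. \<phi> x) = 1" and "(LINT x|lborel. \<psi> x) = 0"
    and \<phi>: "\<And>x. \<phi> x = sqrt 2 * (\<Sum>k\<in>{1 - int N..int N}. h k * \<phi> (2 * x - of_int k))"
    and \<psi>: "\<And>x. \<psi> x = sqrt 2 * (\<Sum>k\<in>{1 - int N..int N}.
                       (- 1) powi k * h (1 - k) * \<phi> (2 * x - of_int k))"
  shows "sqrt 2 * (\<Sum>k\<in>{k\<in>{1 - int N..int N}. even k}. h k) = 1"
    and "sqrt 2 * (\<Sum>k\<in>{k\<in>{1 - int N..int N}. odd k}. h k) = 1"
proof -
  let ?I = "{1 - int N..int N}"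
  note int = integrable_dilated[OF assms(1)]
  have "1 = (LINT x|lborel. sqrt 2 * (\<Sum>k\<in>?I. h k * \<phi> (2 * x - of_int k)))"
    using assms(2) \<phi> by (metis (no_types, lifting) Bochner_Integration.integral_cong)
  also have "\<dots> = sqrt 2 * (\<Sum>k\<in>?I. h k / 2)"
    by (simp add: int integral_dilated assms(2))
  finally have 1: "sqrt 2 * (\<Sum>k\<in>?I. h k) = 2"
    by (simp add: sum_divide_distrib[symmetric])
  have "0 = (LINT x|lborel. sqrt 2 * (\<Sum>k\<in>?I. (- 1) powi k * h (1 - k) * \<phi> (2 * x - of_int k)))"
    using assms(3) \<psi> by (metis (no_types, lifting) Bochner_Integration.integral_cong)
  also have "\<dots> = sqrt 2 * (\<Sum>k\<in>?I. (- 1) powi k * h (1 - k) / 2)"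
    by (simp add: int integral_dilated assms(2))
  finally have "(\<Sum>k\<in>?I. (- 1) powi k * h (1 - k)) = 0"
    by (simp add: sum_divide_distrib[symmetric])
  \<comment> \<open>The reflection \<open>k \<mapsto> 1 - k\<close> preserves the index range;
    afterwards the sign is negative exactly at even \<open>k\<close>.\<close>
  also have "(\<Sum>k\<in>?I. (- 1) powi k * h (1 - k)) = (\<Sum>k\<in>?I. (- 1) powi (1 - k) * h k)"
    by (rule sum.reindex_bij_witness[of _ "\<lambda>k. 1 - k" "\<lambda>k. 1 - k"]) auto
  also have "\<dots> = (\<Sum>k\<in>?I. if even k then - h k else h k)"
    by (intro sum.cong) (auto simp: power_int_minus_left)
  finally have 2: "(\<Sum>k\<in>?I. if even k then - h k else h k) = 0" .
  have 3: "(\<Sum>k\<in>?I. h k) = (\<Sum>k\<in>{k\<in>?I. even k}. h k) + (\<Sum>k\<in>{k\<in>?I. odd k}. h k)"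
    using sum.Int_Diff[of ?I h "{k. even k}"] by (simp add: Int_def set_diff_eq)
  have 4: "(\<Sum>k\<in>{k\<in>?I. even k}. h k) = (\<Sum>k\<in>{k\<in>?I. odd k}. h k)"
    using 2 by (simp add: sum.If_cases sum_negf Int_def)
  show "sqrt 2 * (\<Sum>k\<in>{k\<in>?I. even k}. h k) = 1" "sqrt 2 * (\<Sum>k\<in>{k\<in>?I. odd k}. h k) = 1"
    using 1 unfolding 3 4 by (auto simp: algebra_simps)
qed

lemma Sum_any_int_even_odd:
  fixes g :: "int \<Rightarrow> real"
  assumes "finite {j. g j \<noteq> 0}"
  shows "Sum_any g = Sum_any (\<lambda>m. g (2 * m)) + Sum_any (\<lambda>m. g (2 * m + 1))"
proof -
  have fin: "finite {m. g (2 * m) \<noteq> 0}" "finite {m. g (2 * m + 1) \<noteq> 0}"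
    using finite_vimageI[OF assms, of "\<lambda>m. 2 * m"] finite_vimageI[OF assms, of "\<lambda>m. 2 * m + 1"]
    by (auto simp: inj_def vimage_def)
  have "Sum_any g = sum g ({j. g j \<noteq> 0 \<and> even j} \<union> {j. g j \<noteq> 0 \<and> odd j})"
    unfolding Sum_any.expand_set by (intro sum.cong) auto
  also have "\<dots> = sum g {j. g j \<noteq> 0 \<and> even j} + sum g {j. g j \<noteq> 0 \<and> odd j}"
    using assms by (intro sum.union_disjoint) auto
  also have "sum g {j. g j \<noteq> 0 \<and> even j} = (\<Sum>m\<in>{m. g (2 * m) \<noteq> 0}. g (2 * m))"
    by (rule sum.reindex_bij_witness[of _ "\<lambda>m. 2 * m" "\<lambda>j. j div 2"]) auto
  also have "sum g {j. g j \<noteq> 0 \<and> odd j} = (\<Sum>m\<in>{m. g (2 * m + 1) \<noteq> 0}. g (2 * m + 1))"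
    by (rule sum.reindex_bij_witness[of _ "\<lambda>m. 2 * m + 1" "\<lambda>j. j div 2"]) auto
  finally show ?thesis unfolding Sum_any.expand_set .
qed

text \<open>\<open>Sum_any\<close> allows summing all translates without an index range that depends
  on \<open>y\<close>. A fixed window works for all \<open>y\<close> in a bounded set, which gives
  access to continuity and to termwise integration.\<close>

lemma Sum_any_translates:
  fixes \<phi> :: "real \<Rightarrow> real"
  assumes "\<And>x. x \<notin> {1 - real N..real N} \<Longrightarrow> \<phi> x = 0"
    and "real N + \<bar>y\<bar> < of_int A"
  shows "Sum_any (\<lambda>m. \<phi> (y - of_int m)) = (\<Sum>m\<in>{- A..A}. \<phi> (y - of_int m))"
    and "finite {m. \<phi> (y - of_int m) \<noteq> 0}"
proof -
  have "m \<in> {- A..A}" if "\<phi> (y - of_int m) \<noteq> 0" for m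
  proof -
    have "y - of_int m \<in> {1 - real N..real N}" using that assms(1) by blast
    then have "(of_int m :: real) \<le> of_int A" "(of_int (- A) :: real) \<le> of_int m"
      using assms(2) by auto
    then show ?thesis by (simp only: of_int_le_iff) simp
  qed
  then have "{m. \<phi> (y - of_int m) \<noteq> 0} \<subseteq> {- A..A}" by blast
  then show "Sum_any (\<lambda>m. \<phi> (y - of_int m)) = (\<Sum>m\<in>{- A..A}. \<phi> (y - of_int m))"
    "finite {m. \<phi> (y - of_int m) \<noteq> 0}"
    by (auto intro: Sum_any.expand_superset finite_subset)
qed

text \<open>
  The sum \<open>F\<close> of all integer translates satisfies \<open>F y = F (2 y)\<close>, so continuity at 0 makes it
  constant; orthonormality of the translates identifies the constant.
\<close>

lemma refinable_partition_of_unity: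
  fixes \<phi> :: "real \<Rightarrow> real" and h :: "int \<Rightarrow> real"
  assumes cont: "continuous_on UNIV \<phi>"
    and supp: "\<And>x. x \<notin> {1 - real N..real N} \<Longrightarrow> \<phi> x = 0"
    and \<phi>: "\<And>x. \<phi> x = sqrt 2 * (\<Sum>k\<in>{1 - int N..int N}. h k * \<phi> (2 * x - of_int k))"
    and even: "sqrt 2 * (\<Sum>k\<in>{k\<in>{1 - int N..int N}. even k}. h k) = 1"
    and odd: "sqrt 2 * (\<Sum>k\<in>{k\<in>{1 - int N..int N}. odd k}. h k) = 1"
    and int: "(LINT x|lborel. \<phi> x) = 1"
    and orth: "\<And>m :: int. (LINT x|lborel. \<phi> x * \<phi> (x - of_int m)) = (if m = 0 then 1 else 0)"
  shows "Sum_any (\<lambda>m. \<phi> (y - of_int m)) = 1"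
proof -
  let ?I = "{1 - int N..int N}"
  define F where "F y = Sum_any (\<lambda>m. \<phi> (y - of_int m))" for y
  \<comment> \<open>In the refinement equation at \<open>y - m\<close> the arguments are
    \<open>2 * y - k - 2 * m\<close>, so summing over \<open>m\<close> gives \<open>E\<close> at
    \<open>2 * y - k\<close>. As \<open>E\<close> has period 2, only the parity of \<open>k\<close>
    matters.\<close>
  define E where "E y = Sum_any (\<lambda>m. \<phi> (y - of_int (2 * m)))" for y
  have fin: "finite {m. \<phi> (y - of_int m) \<noteq> 0}" for y
    by (rule Sum_any_translates(2)[of N \<phi> y "\<lceil>real N + \<bar>y\<bar>\<rceil> + 1"]) (auto simp: supp, linarith)
  have fin2: "finite {m. \<phi> (y - of_int (2 * m)) \<noteq> 0}" for y
    using finite_vimageI[OF fin[of y], of "\<lambda>m. 2 * m"] by (auto simp: inj_def vimage_def)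
  have E_shift: "E (y - of_int (2 * i)) = E y" for y and i :: int
    unfolding E_def Sum_any.expand_set
    by (rule sum.reindex_bij_witness[of _ "\<lambda>m. m - i" "\<lambda>m. m + i"]) (auto simp: algebra_simps)
  have F_E: "F y = E y + E (y - 1)" for y
  proof -
    have eq: "y - 1 - of_int (2 * m) = y - of_int (2 * m + 1)" for m :: int by simp
    show ?thesis
      unfolding F_def E_def eq by (rule Sum_any_int_even_odd[OF fin])
  qed
  have F_double: "F y = F (2 * y)" for y
  proof -
    have fin': "finite (\<Union>k\<in>?I. {m. \<phi> (2 * y - of_int k - of_int (2 * m)) \<noteq> 0})"
      using fin2 by blast
    \<comment> \<open>One finite set that contains the supports of all sums involved, so that the
      summations over \<open>m\<close> and \<open>k\<close> can be exchanged.\<close>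
    define A where "A = {m. \<phi> (y - of_int m) \<noteq> 0} \<union>
      (\<Union>k\<in>?I. {m. \<phi> (2 * y - of_int k - of_int (2 * m)) \<noteq> 0})"
    have "finite A" unfolding A_def using fin fin' by blast
    have "F y = (\<Sum>m\<in>A. \<phi> (y - of_int m))"
      unfolding F_def using \<open>finite A\<close> by (intro Sum_any.expand_superset) (auto simp: A_def)
    also have "\<dots> = (\<Sum>m\<in>A. sqrt 2 * (\<Sum>k\<in>?I. h k * \<phi> (2 * y - of_int k - of_int (2 * m))))"
      by (subst \<phi>) (simp add: algebra_simps)
    also have "\<dots> = sqrt 2 * (\<Sum>k\<in>?I. h k * (\<Sum>m\<in>A. \<phi> (2 * y - of_int k - of_int (2 * m))))"
      by (subst sum_distrib_left[symmetric], subst sum.swap) (simp add: sum_distrib_left)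
    also have "\<dots> = sqrt 2 * (\<Sum>k\<in>?I. h k * E (2 * y - of_int k))"
    proof -
      have "E (2 * y - of_int k) = (\<Sum>m\<in>A. \<phi> (2 * y - of_int k - of_int (2 * m)))" if "k \<in> ?I" for k
        unfolding E_def using \<open>finite A\<close> that by (intro Sum_any.expand_superset) (auto simp: A_def)
      then show ?thesis by simp
    qed
    also have "\<dots> = sqrt 2 * (\<Sum>k\<in>?I. h k * (if even k then E (2 * y) else E (2 * y - 1)))"
    proof -
      have "E (2 * y - of_int k) = (if even k then E (2 * y) else E (2 * y - 1))" for k
      proof (cases "even k")
        case True
        then show ?thesis using E_shift[of "2 * y" "k div 2"] by simp
      next
        case False
        then have eq: "2 * y - of_int k = 2 * y - 1 - of_int (2 * (k div 2))"
          by (auto elim!: oddE)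
        show ?thesis using E_shift[of "2 * y - 1" "k div 2"] False unfolding eq by simp
      qed
      then show ?thesis by simp
    qed
    also have "\<dots> = sqrt 2 * ((\<Sum>k\<in>{k\<in>?I. even k}. h k * E (2 * y))
                        + (\<Sum>k\<in>{k\<in>?I. odd k}. h k * E (2 * y - 1)))"
      by (simp add: sum.If_cases Int_def if_distrib[of "\<lambda>z. _ * z"])
    also have "\<dots> = (sqrt 2 * (\<Sum>k\<in>{k\<in>?I. even k}. h k)) * E (2 * y)
                 + (sqrt 2 * (\<Sum>k\<in>{k\<in>?I. odd k}. h k)) * E (2 * y - 1)"
      by (simp only: sum_distrib_right distrib_left mult.assoc)
    also have "\<dots> = F (2 * y)" unfolding even odd F_E[of "2 * y"] by simp
    finally show ?thesis .
  qed
  have F_const: "F y = F 0" for y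
  proof -
    \<comment> \<open>This window serves all \<open>z\<close> with
      \<open>\<bar>z\<bar> \<le> 1\<close>, so near 0 the function \<open>F\<close> is a finite sum
      of continuous functions.\<close>
    define A where "A = int N + 2"
    have F_near: "F z = (\<Sum>m\<in>{- A..A}. \<phi> (z - of_int m))" if "\<bar>z\<bar> \<le> 1" for z
      unfolding F_def using that by (intro Sum_any_translates(1)[of N \<phi>, OF supp]) (auto simp: A_def)
    have iter: "F (y / 2 ^ n) = F y" for n
    proof (induction n)
      case (Suc n)
      then show ?case using F_double[of "y / 2 ^ Suc n"] by simp
    qed simp
    have lim: "(\<lambda>n. y / 2 ^ n) \<longlonglongrightarrow> 0"
      using LIMSEQ_divide_realpow_zero[of 2 y] by simp
    have "(\<lambda>n. \<Sum>m\<in>{- A..A}. \<phi> (y / 2 ^ n - of_int m)) \<longlonglongrightarrow> (\<Sum>m\<in>{- A..A}. \<phi> (0 - of_int m))"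
      by (intro tendsto_sum continuous_on_tendsto_compose[OF cont] tendsto_diff lim) auto
    moreover have "\<forall>\<^sub>F n in sequentially. (\<Sum>m\<in>{- A..A}. \<phi> (y / 2 ^ n - of_int m)) = F y"
    proof -
      have "\<forall>\<^sub>F n in sequentially. \<bar>y / 2 ^ n\<bar> < 1"
        using tendstoD[OF lim, of 1] by simp
      then show ?thesis
        by (rule eventually_mono) (metis F_near iter less_imp_le)
    qed
    ultimately have "(\<lambda>n. F y) \<longlonglongrightarrow> (\<Sum>m\<in>{- A..A}. \<phi> (0 - of_int m))"
      by (rule Lim_transform_eventually)
    then show ?thesis
      using F_near[of 0] by (simp add: LIMSEQ_const_iff)
  qed
  \<comment> \<open>On the support of \<open>\<phi>\<close>, where
    \<open>\<bar>x\<bar> \<le> N\<close>, this window captures every translate that counts. The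
    integral of \<open>\<phi> * F\<close> is then computed twice: constancy of \<open>F\<close>
    gives \<open>F 0\<close>, orthonormality gives 1.\<close>
  define A where "A = 2 * int N + 2"
  have prod: "\<phi> x * F x = (\<Sum>m\<in>{- A..A}. \<phi> x * \<phi> (x - of_int m))" for x
  proof (cases "x \<in> {1 - real N..real N}")
    case True
    then have "F x = (\<Sum>m\<in>{- A..A}. \<phi> (x - of_int m))"
      unfolding F_def by (intro Sum_any_translates(1)[of N \<phi>, OF supp]) (auto simp: A_def)
    then show ?thesis by (simp add: sum_distrib_left)
  qed (simp add: supp)
  have eq: "F 0 * \<phi> x = (\<Sum>m\<in>{- A..A}. \<phi> x * \<phi> (x - of_int m))" for x
    unfolding prod[symmetric] by (simp add: F_const[of x])
  have "F 0 = (LINT x|lborel. F 0 * \<phi> x)" by (simp add: int)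
  also have "\<dots> = (LINT x|lborel. (\<Sum>m\<in>{- A..A}. \<phi> x * \<phi> (x - of_int m)))"
    unfolding eq ..
  also have "\<dots> = (\<Sum>m\<in>{- A..A}. LINT x|lborel. \<phi> x * \<phi> (x - of_int m))"
  proof (rule Bochner_Integration.integral_sum)
    fix m
    have "continuous_on UNIV (\<lambda>x. \<phi> x * \<phi> (x - of_int m))"
      by (intro continuous_intros cont continuous_on_compose2[OF cont]) auto
    then show "integrable lborel (\<lambda>x. \<phi> x * \<phi> (x - of_int m))"
      by (rule integrable_continuous_compact_support[where a = "1 - real N" and b = "real N"])
        (simp add: supp)
  qed
  also have "\<dots> = 1"
    by (simp add: orth A_def)
  finally show ?thesis using F_const[of y] unfolding F_def by simp
qed

text \<open>Uniqueness of the limit from the right. Applied to \<open>\<phi>\<close> and its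
  reflection, it removes the end points of the support interval and so fixes the exact range of
  relevant translates.\<close>

lemma continuous_zero_above:
  fixes f :: "real \<Rightarrow> real"
  assumes "continuous_on UNIV f" and "\<And>x. b < x \<Longrightarrow> f x = 0"
  shows "f b = 0"
proof (rule tendsto_unique)
  show "(f \<longlongrightarrow> f b) (at_right b)"
    using assms(1) by (meson UNIV_I continuous_on_def subset_UNIV tendsto_within_subset)
  show "(f \<longlongrightarrow> 0) (at_right b)"
    using assms(2) by (intro tendsto_eventually) (auto simp: eventually_at_right_less eventually_at_filter)
qed simp

lemma daubechies_pair_partition_of_unity:
  assumes pair: "daubechies_pair N \<phi> \<psi>" and "1 \<le> N" and cont: "continuous_on UNIV \<phi>"
  shows "Sum_any (\<lambda>m. \<phi> (y - of_int m)) = 1"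
proof -
  obtain h where \<phi>: "\<And>x. \<phi> x = sqrt 2 * (\<Sum>k\<in>{1 - int N..int N}. h k * \<phi> (2 * x - of_int k))"
    and \<psi>: "\<And>x. \<psi> x = sqrt 2 * (\<Sum>k\<in>{1 - int N..int N}.
                       (- 1) powi k * h (1 - k) * \<phi> (2 * x - of_int k))"
    using pair unfolding daubechies_pair_def by blast
  have supp: "\<And>x. x \<notin> {1 - real N..real N} \<Longrightarrow> \<phi> x = 0"
    and int: "(LINT x|lborel. \<phi> x) = 1"
    and orth: "\<And>m :: int. (LINT x|lborel. \<phi> x * \<phi> (x - of_int m)) = (if m = 0 then 1 else 0)"
    using pair unfolding daubechies_pair_def by blast+
  have "(LINT x|lborel. x ^ 0 * \<psi> x) = 0"
    using pair \<open>1 \<le> N\<close> unfolding daubechies_pair_def by (metis less_le_trans zero_less_one)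
  then have "(LINT x|lborel. \<psi> x) = 0" by simp
  then show ?thesis
    using even_odd_filter_sums[OF integrable_continuous_compact_support[OF cont supp] int _ \<phi> \<psi>]
    by (intro refinable_partition_of_unity[of \<phi> N h, OF cont supp \<phi> _ _ int orth]) auto
qed

text \<open>For \<open>k\<close> in the index range, \<open>2 * x - k\<close> in
  \<open>[1 - N, N]\<close> forces \<open>2 * x\<close> into \<open>[2 - 2 * N, 2 * N]\<close>; thus
  \<open>\<psi>\<close> inherits the support interval of \<open>\<phi>\<close>.\<close>

lemma daubechies_wavelet_support:
  assumes "daubechies_pair N \<phi> \<psi>" and "x \<notin> {1 - real N..real N}"
  shows "\<psi> x = 0"
proof -
  obtain h where \<psi>: "\<And>x. \<psi> x = sqrt 2 * (\<Sum>k\<in>{1 - int N..int N}.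
                       (- 1) powi k * h (1 - k) * \<phi> (2 * x - of_int k))"
    using assms(1) unfolding daubechies_pair_def by blast
  have "\<phi> (2 * x - of_int k) = 0" if "k \<in> {1 - int N..int N}" for k
  proof -
    have "(of_int (1 - int N) :: real) \<le> of_int k" "(of_int k :: real) \<le> of_int (int N)"
      using that by (simp_all only: of_int_le_iff) auto
    then have "2 * x - of_int k \<notin> {1 - real N..real N}" using assms(2) by auto
    then show ?thesis using assms(1) unfolding daubechies_pair_def by blast
  qed
  then show ?thesis by (subst \<psi>) simp
qed

section \<open>Boundary correction and the constant function on the unit interval\<close>

lemma constant_in_edge_space:
  assumes "1 \<le> N"
  shows "(\<lambda>x. \<Sum>m\<in>M. \<phi> (x - of_int m)) \<in> edge_space N \<phi> M"
  unfolding edge_space_def using assms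
  by (intro CollectI exI[of _ "[:1:]"]) auto

text \<open>At scale \<open>2 ^ J\<close> the partition of unity splits into a left, an interior and
  a right group of translates. The outer groups are the elements of the edge spaces for the
  polynomial 1, hence combinations of edge scaling functions.\<close>

lemma constant_in_scaling_span:
  fixes \<phi> :: "real \<Rightarrow> real"
  assumes unity: "\<And>y. Sum_any (\<lambda>m. \<phi> (y - of_int m)) = 1"
    and cont: "continuous_on UNIV \<phi>"
    and supp: "\<And>x. x \<notin> {1 - real N..real N} \<Longrightarrow> \<phi> x = 0"
    and N: "1 \<le> N" "2 * N \<le> 2 ^ J"
    and L: "edge_scaling N \<phi> {0..} {1 - int N..int N - 1} \<phi>L"
    and R: "edge_scaling N \<phi> {..0} {- int N..int N - 2} \<phi>R"
  obtains c where "\<And>x. x \<in> {0..1} \<Longrightarrow> (\<Sum>k\<in>{1..2 ^ J}. c k * level_fun N \<phi> \<phi>L \<phi>R J k x) = 1"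
proof -
  obtain a where a: "\<And>x. x \<ge> 0 \<Longrightarrow>
      (\<Sum>m\<in>{1 - int N..int N - 1}. \<phi> (x - of_int m)) = (\<Sum>j<N. a j * \<phi>L j x)"
    using L constant_in_edge_space[OF N(1)] unfolding edge_scaling_def by fastforce
  obtain b where b: "\<And>x. x \<le> 0 \<Longrightarrow>
      (\<Sum>m\<in>{- int N..int N - 2}. \<phi> (x - of_int m)) = (\<Sum>j<N. b j * \<phi>R j x)"
    using R constant_in_edge_space[OF N(1)] unfolding edge_scaling_def by fastforce
  \<comment> \<open>The power of 2 cancels the normalisation in \<open>level_fun\<close>. Interior
    translates get weight 1; edge functions are numbered from 0 at their own end point.\<close>
  define c where "c k = 2 powr (- (real J / 2)) *
    (if k \<le> N then a (k - 1) else if k \<le> 2 ^ J - N then 1 else b (2 ^ J - k))" for k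
  show ?thesis
  proof (rule that[of c])
    fix x :: real assume x: "x \<in> {0..1}"
    define y where "y = 2 ^ J * x"
    have y: "0 \<le> y" "y \<le> 2 ^ J" using x by (auto simp: y_def)
    have \<phi>N: "\<phi> (real N) = 0" using continuous_zero_above[OF cont] supp by auto
    have \<phi>N': "\<phi> (1 - real N) = 0"
      using continuous_zero_above[of "\<lambda>x. \<phi> (- x)" "real N - 1"] supp
        continuous_on_compose2[OF cont continuous_on_minus[OF continuous_on_id]] by auto
    let ?g = "\<lambda>m :: int. \<phi> (y - of_int m)"
    let ?h = "\<lambda>k. c k * level_fun N \<phi> \<phi>L \<phi>R J k x"
    have pow: "2 powr - (real J / 2) * 2 powr (real J / 2) = (1 :: real)"
      by (simp flip: powr_add)
    have scale: "(2 powr - (real J / 2) * u) * (2 powr (real J / 2) * v) = u * v" for u v :: real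
      using pow by (metis mult.assoc mult.left_commute mult.left_neutral)
    define P :: nat where "P = 2 ^ J"
    have P: "2 * N \<le> P" "2 ^ J = P" "2 ^ J = real P" using N(2) by (auto simp: P_def)

    have "1 = sum ?g {1 - int N..int P + int N - 2}"
    proof -
      \<comment> \<open>Since \<open>\<phi>\<close> vanishes at both ends of its support, the bounds
        on \<open>y - m\<close> are strict. With \<open>0 \<le> y \<le> P\<close> this leaves the
        integers from \<open>1 - N\<close> to \<open>P + N - 2\<close>.\<close>
      have "m \<in> {1 - int N..int P + int N - 2}" if "?g m \<noteq> 0" for m
      proof -
        have "y - of_int m \<in> {1 - real N..real N}" "y - of_int m \<noteq> real N" "y - of_int m \<noteq> 1 - real N"
          using that supp \<phi>N \<phi>N' by metis+
        then have "1 - real N < y - of_int m" "y - of_int m < real N" by auto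
        then have "(of_int (- int N) :: real) < of_int m" "(of_int m :: real) < of_int (int P + int N - 1)"
          using y P(3) by auto
        then show ?thesis unfolding of_int_less_iff by auto
      qed
      then show ?thesis
        unfolding unity[of y, symmetric] by (intro Sum_any.expand_superset) auto
    qed
    also have "{1 - int N..int P + int N - 2} = {1 - int N..int N - 1} \<union> {int N..int P - int N - 1}
                   \<union> {int P - int N..int P + int N - 2}"
      using P(1) N(1) by auto
    also have "sum ?g \<dots> = sum ?g {1 - int N..int N - 1} + sum ?g {int N..int P - int N - 1}
                   + sum ?g {int P - int N..int P + int N - 2}"
      using P(1) N(1) by (subst sum.union_disjoint, force, force, force, subst sum.union_disjoint) auto
    also have "sum ?g {1 - int N..int N - 1} = sum ?h {1..N}"
    proof -
      have "sum ?h {1..N} = (\<Sum>k\<in>{1..N}. a (k - 1) * \<phi>L (k - 1) y)"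
        by (intro sum.cong) (simp_all add: c_def level_fun_def y_def scale)
      also have "\<dots> = (\<Sum>j<N. a j * \<phi>L j y)"
        by (rule sum.reindex_bij_witness[of _ Suc "\<lambda>k. k - 1"]) auto
      finally show ?thesis using a[OF y(1)] by simp
    qed
    also have "sum ?g {int N..int P - int N - 1} = sum ?h {N + 1..P - N}"
    proof -
      have "sum ?h {N + 1..P - N} = (\<Sum>k\<in>{N + 1..P - N}. \<phi> (y - real (k - 1)))"
      proof (rule sum.cong)
        fix k assume "k \<in> {N + 1..P - N}"
        then show "?h k = \<phi> (y - real (k - 1))"
          using scale[of 1 "\<phi> (y - real (k - 1))"] by (simp add: c_def level_fun_def y_def P)
      qed simp
      \<comment> \<open>The \<open>k\<close>-th interior function of a level is the translate by
        \<open>k - 1\<close>.\<close>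
      also have "\<dots> = sum ?g {int N..int P - int N - 1}"
        by (rule sum.reindex_bij_witness[of _ "\<lambda>m. nat (m + 1)" "\<lambda>k. int (k - 1)"]) (use P(1) in auto)
      finally show ?thesis by simp
    qed
    also have "sum ?g {int P - int N..int P + int N - 2} = sum ?h {P - N + 1..P}"
    proof -
      have "sum ?h {P - N + 1..P} = (\<Sum>k\<in>{P - N + 1..P}. b (P - k) * \<phi>R (P - k) (real P * (x - 1)))"
        using P(1) by (intro sum.cong) (auto simp: c_def level_fun_def scale P(2,3))
      also have "\<dots> = (\<Sum>j<N. b j * \<phi>R j (real P * (x - 1)))"
        using P(1) by (intro sum.reindex_bij_witness[of _ "\<lambda>j. P - j" "\<lambda>k. P - k"]) auto
      also have "\<dots> = (\<Sum>m\<in>{- int N..int N - 2}. \<phi> (real P * (x - 1) - of_int m))"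
        using x by (intro b[symmetric]) (simp add: mult_nonneg_nonpos)
      \<comment> \<open>Right edge functions live in the coordinate
        \<open>P * (x - 1) = y - P\<close>, whence the shift of the index set by
        \<open>P\<close>.\<close>
      also have "\<dots> = sum ?g {int P - int N..int P + int N - 2}"
        by (rule sum.reindex_bij_witness[of _ "\<lambda>m. m - int P" "\<lambda>m. m + int P"])
          (auto simp: y_def P(3) algebra_simps)
      finally show ?thesis by simp
    qed
    also have "sum ?h {1..N} + sum ?h {N + 1..P - N} + sum ?h {P - N + 1..P}
             = sum ?h ({1..N} \<union> {N + 1..P - N} \<union> {P - N + 1..P})"
      using P(1) by (subst sum.union_disjoint, force, force, force, subst sum.union_disjoint) auto
    also have "{1..N} \<union> {N + 1..P - N} \<union> {P - N + 1..P} = {1..2 ^ J}"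
      using P(1) unfolding P(2) by auto
    finally show "sum ?h {1..2 ^ J} = 1" ..
  qed
qed

text \<open>Extracts from the construction what is used besides orthonormality: one compactly
  supported generator for the interior wavelets, and coefficients that represent the constant
  1.\<close>

lemma daubechies_basis_interior:
  assumes "daubechies_basis S J0 \<Phi> \<Psi>" and "0 < S"
  obtains N \<psi> c where "1 \<le> N" "2 * N \<le> 2 ^ J0" "continuous_on UNIV \<psi>"
    "\<And>x. x \<notin> {1 - real N..real N} \<Longrightarrow> \<psi> x = 0"
    "\<And>l k x. J0 \<le> l \<Longrightarrow> N < k \<Longrightarrow> k \<le> 2 ^ l - N \<Longrightarrow> x \<in> {0..1} \<Longrightarrow>
       \<Psi> l k x = 2 powr (real l / 2) * \<psi> (2 ^ l * x - real (k - 1))"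
    "\<And>x. x \<in> {0..1} \<Longrightarrow> (\<Sum>k\<in>{1..2 ^ J0}. c k * \<Phi> k x) = 1"
proof -
  obtain N \<phi> \<psi> \<phi>L \<phi>R \<psi>L \<psi>R where
    N: "1 \<le> N" "2 * N \<le> 2 ^ J0" and pair: "daubechies_pair N \<phi> \<psi>"
    and smooth: "C_times S \<phi>" "C_times S \<psi>"
    and edge: "edge_scaling N \<phi> {0..} {1 - int N..int N - 1} \<phi>L"
      "edge_scaling N \<phi> {..0} {- int N..int N - 2} \<phi>R"
    and \<Phi>: "\<forall>k\<in>{1..2 ^ J0}. \<forall>x\<in>{0..1}. \<Phi> k x = level_fun N \<phi> \<phi>L \<phi>R J0 k x"
    and \<Psi>: "\<forall>(l, k)\<in>wavelet_index J0. \<forall>x\<in>{0..1}. \<Psi> l k x = level_fun N \<psi> \<psi>L \<psi>R l k x"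
    using assms(1) unfolding daubechies_basis_def by (elim conjE exE) (rule that; assumption)
  note cont = C_times_continuous[OF smooth(1) assms(2)] C_times_continuous[OF smooth(2) assms(2)]
  have supp: "\<phi> x = 0" if "x \<notin> {1 - real N..real N}" for x
    using pair that unfolding daubechies_pair_def by blast
  obtain c where c: "\<And>x. x \<in> {0..1} \<Longrightarrow>
      (\<Sum>k\<in>{1..2 ^ J0}. c k * level_fun N \<phi> \<phi>L \<phi>R J0 k x) = 1"
    using constant_in_scaling_span[of \<phi> N, OF daubechies_pair_partition_of_unity[OF pair N(1) cont(1)]
        cont(1) supp N edge] by blast
  show thesis
  proof (rule that[OF N cont(2) daubechies_wavelet_support[OF pair]])
    fix l k and x :: real
    assume lk: "J0 \<le> l" "N < k" "k \<le> 2 ^ l - N" and x: "x \<in> {0..1}"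
    then have "(l, k) \<in> wavelet_index J0" unfolding wavelet_index_def by auto
    then have "\<Psi> l k x = level_fun N \<psi> \<psi>L \<psi>R l k x" using \<Psi> x by blast
    then show "\<Psi> l k x = 2 powr (real l / 2) * \<psi> (2 ^ l * x - real (k - 1))"
      using lk by (simp add: level_fun_def)
  next
    fix x :: real assume "x \<in> {0..1}"
    then show "(\<Sum>k\<in>{1..2 ^ J0}. c k * \<Phi> k x) = 1" using c[of x] \<Phi> by simp
  qed
qed

section \<open>Square-integrable functions on a set\<close>

lemma L2_on_set_integrable_mult:
  assumes "L2_on A f" and "L2_on A g"
  shows "set_integrable lborel A (\<lambda>x. f x * g x)"
proof -
  have sq: "integrable lborel (\<lambda>x. indicat_real A x *\<^sub>R (f x)\<^sup>2)"
    "integrable lborel (\<lambda>x. indicat_real A x *\<^sub>R (g x)\<^sup>2)"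
    and meas: "(\<lambda>x. indicat_real A x *\<^sub>R f x) \<in> borel_measurable lborel"
    "(\<lambda>x. indicat_real A x *\<^sub>R g x) \<in> borel_measurable lborel"
    using assms unfolding L2_on_def set_integrable_def set_borel_measurable_def by auto
  have eq: "indicat_real A x *\<^sub>R (f x * g x) = (indicat_real A x *\<^sub>R f x) * (indicat_real A x *\<^sub>R g x)" for x
    by (simp add: indicator_def)
  show ?thesis unfolding set_integrable_def
  proof (rule Bochner_Integration.integrable_bound[OF Bochner_Integration.integrable_add[OF sq]])
    show "(\<lambda>x. indicat_real A x *\<^sub>R (f x * g x)) \<in> borel_measurable lborel"
      unfolding eq using meas by measurable
    have "\<bar>u * v\<bar> \<le> u\<^sup>2 + v\<^sup>2" for u v :: real
    proof -
      have "2 * \<bar>u * v\<bar> \<le> u\<^sup>2 + v\<^sup>2"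
        using sum_squares_bound[of "\<bar>u\<bar>" "\<bar>v\<bar>"] by (simp add: abs_mult mult.assoc)
      then show ?thesis using abs_ge_zero[of "u * v"] by linarith
    qed
    then show "AE x in lborel. norm (indicat_real A x *\<^sub>R (f x * g x))
        \<le> norm (indicat_real A x *\<^sub>R (f x)\<^sup>2 + indicat_real A x *\<^sub>R (g x)\<^sup>2)"
      by (auto simp: indicator_def)
  qed
qed

lemma continuous_on_L2_on_Icc:
  fixes f :: "real \<Rightarrow> real"
  assumes "continuous_on {a..b} f"
  shows "L2_on {a..b} f"
  unfolding L2_on_def set_borel_measurable_def
  using borel_integrable_atLeastAtMost'[OF assms]
    borel_integrable_atLeastAtMost'[OF continuous_on_power[OF assms, of 2]]
  by (auto simp: set_integrable_def)

lemma set_integral_sum: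
  fixes f :: "'i \<Rightarrow> 'a \<Rightarrow> real"
  assumes "\<And>i. i \<in> I \<Longrightarrow> set_integrable M A (f i)"
  shows "(LINT x:A|M. (\<Sum>i\<in>I. f i x)) = (\<Sum>i\<in>I. LINT x:A|M. f i x)"
  using assms unfolding set_lebesgue_integral_def set_integrable_def scaleR_sum_right
  by (rule Bochner_Integration.integral_sum)

subsection \<open>Wavelet perturbations of the uniform density\<close>

context
  fixes S J0 :: nat and \<Phi> :: "nat \<Rightarrow> real \<Rightarrow> real" and \<Psi> :: "nat \<Rightarrow> nat \<Rightarrow> real \<Rightarrow> real"
  assumes basis: "daubechies_basis S J0 \<Phi> \<Psi>" and S: "0 < S"
begin

lemma
  shows scaling_L2: "j \<in> {1..2 ^ J0} \<Longrightarrow> L2_on {0..1} (\<Phi> j)"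
    and wavelet_L2: "(l, k) \<in> wavelet_index J0 \<Longrightarrow> L2_on {0..1} (\<Psi> l k)"
proof -
  have L2: "L2_on {0..1} (case_sum \<Phi> (\<lambda>(l, k). \<Psi> l k) i)"
    if "i \<in> {1..2 ^ J0} <+> wavelet_index J0" for i
    using basis that unfolding daubechies_basis_def L2_orthonormal_basis_def by blast
  show "L2_on {0..1} (\<Phi> j)" if "j \<in> {1..2 ^ J0}" using L2[OF InlI[OF that]] by simp
  show "L2_on {0..1} (\<Psi> l k)" if "(l, k) \<in> wavelet_index J0" using L2[OF InrI[OF that]] by simp
qed

lemma
  shows scaling_norm: "j \<in> {1..2 ^ J0} \<Longrightarrow> (LINT x:{0..1}|lborel. \<Phi> j x * \<Phi> j x) = 1"
    and wavelet_scaling_orthogonal: "(l, k) \<in> wavelet_index J0 \<Longrightarrow> j \<in> {1..2 ^ J0} \<Longrightarrow>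
      (LINT x:{0..1}|lborel. \<Psi> l k x * \<Phi> j x) = 0"
    and wavelet_orthonormal: "(l, k) \<in> wavelet_index J0 \<Longrightarrow> (l', k') \<in> wavelet_index J0 \<Longrightarrow>
      (LINT x:{0..1}|lborel. \<Psi> l k x * \<Psi> l' k' x) = (if l = l' \<and> k = k' then 1 else 0)"
proof -
  let ?I = "{1..2 ^ J0} <+> wavelet_index J0"
  let ?e = "case_sum \<Phi> (\<lambda>(l, k). \<Psi> l k)"
  have orth: "inner_on {0..1} (?e i) (?e j) = (if i = j then 1 else 0)" if "i \<in> ?I" "j \<in> ?I" for i j
    using basis that unfolding daubechies_basis_def L2_orthonormal_basis_def by blast
  show "(LINT x:{0..1}|lborel. \<Phi> j x * \<Phi> j x) = 1" if "j \<in> {1..2 ^ J0}"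
    using orth[OF InlI[OF that] InlI[OF that]] by (simp add: inner_on_def)
  show "(LINT x:{0..1}|lborel. \<Psi> l k x * \<Phi> j x) = 0"
    if "(l, k) \<in> wavelet_index J0" "j \<in> {1..2 ^ J0}"
    using orth[OF InrI[OF that(1)] InlI[OF that(2)]] by (simp add: inner_on_def)
  show "(LINT x:{0..1}|lborel. \<Psi> l k x * \<Psi> l' k' x) = (if l = l' \<and> k = k' then 1 else 0)"
    if "(l, k) \<in> wavelet_index J0" "(l', k') \<in> wavelet_index J0"
    using orth[OF InrI[OF that(1)] InrI[OF that(2)]] by (simp add: inner_on_def)
qed

text \<open>The constant 1 is a combination of the \<open>\<Phi> j\<close>, to which
  \<open>\<Psi> l k\<close> is orthogonal. Adding a multiple of a wavelet to the uniform density
  thus preserves total mass.\<close>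

lemma wavelet_integral_zero:
  assumes lk: "(l, k) \<in> wavelet_index J0"
  shows "(LINT x:{0..1}|lborel. \<Psi> l k x) = 0"
proof -
  obtain c where c: "\<And>x. x \<in> {0..1} \<Longrightarrow> (\<Sum>k\<in>{1..2 ^ J0}. c k * \<Phi> k x) = 1"
    using daubechies_basis_interior[OF basis S] by metis
  have "(LINT x:{0..1}|lborel. \<Psi> l k x)
      = (LINT x:{0..1}|lborel. (\<Sum>j\<in>{1..2 ^ J0}. c j * (\<Psi> l k x * \<Phi> j x)))"
  proof (rule set_lebesgue_integral_cong)
    have "\<Psi> l k x = \<Psi> l k x * (\<Sum>j\<in>{1..2 ^ J0}. c j * \<Phi> j x)" if "x \<in> {0..1}" for x
      using c[OF that] by simp
    then show "\<forall>x. x \<in> {0..1} \<longrightarrow> \<Psi> l k x = (\<Sum>j\<in>{1..2 ^ J0}. c j * (\<Psi> l k x * \<Phi> j x))"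
      by (simp add: sum_distrib_left mult.left_commute)
  qed simp
  also have "\<dots> = (\<Sum>j\<in>{1..2 ^ J0}. LINT x:{0..1}|lborel. c j * (\<Psi> l k x * \<Phi> j x))"
    using L2_on_set_integrable_mult[OF wavelet_L2[OF lk] scaling_L2]
    by (intro set_integral_sum set_integrable_mult_right) auto
  also have "\<dots> = 0"
    using wavelet_scaling_orthogonal[OF lk] by simp
  finally show ?thesis .
qed

text \<open>From \<open>\<bar>u\<bar> \<le> (1 + u * u) / 2\<close> and the unit norm of
  \<open>\<Phi> j\<close>. This bounds the scaling coefficients of the uniform density, so that a
  radius \<open>B \<ge> 1\<close> is enough.\<close>

lemma scaling_integral_le_1:
  assumes j: "j \<in> {1..2 ^ J0}"
  shows "\<bar>LINT x:{0..1}|lborel. \<Phi> j x\<bar> \<le> 1"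
proof -
  have int\<Phi>: "set_integrable lborel {0..1} (\<Phi> j)"
    using L2_on_set_integrable_mult[OF continuous_on_L2_on_Icc[of 0 1 "\<lambda>x. 1"] scaling_L2[OF j]] by simp
  have int\<Phi>2: "set_integrable lborel {0..1} (\<lambda>x. \<Phi> j x * \<Phi> j x)"
    by (rule L2_on_set_integrable_mult[OF scaling_L2[OF j] scaling_L2[OF j]])
  have intc: "set_integrable lborel {0..1 :: real} (\<lambda>x. 1 / 2 :: real)"
    by (intro borel_integrable_atLeastAtMost' continuous_on_const)
  have "(LINT x:{0..1}|lborel. \<bar>\<Phi> j x\<bar>) \<le> (LINT x:{0..1}|lborel. 1 / 2 + \<Phi> j x * \<Phi> j x / 2)"
  proof (rule set_integral_mono)
    show "set_integrable lborel {0..1} (\<lambda>x. \<bar>\<Phi> j x\<bar>)" using int\<Phi> by (rule set_integrable_abs)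
    show "set_integrable lborel {0..1} (\<lambda>x. 1 / 2 + \<Phi> j x * \<Phi> j x / 2)"
      using int\<Phi>2 by (intro set_integral_add set_integrable_divide intc)
    show "\<bar>\<Phi> j x\<bar> \<le> 1 / 2 + \<Phi> j x * \<Phi> j x / 2" for x
      using sum_squares_bound[of 1 "\<bar>\<Phi> j x\<bar>"] by (simp add: power2_eq_square)
  qed
  also have "\<dots> = (LINT x:{0..1 :: real}|lborel. 1 / 2 :: real) + (LINT x:{0..1}|lborel. \<Phi> j x * \<Phi> j x / 2)"
    using int\<Phi>2 by (intro set_integral_add set_integrable_divide intc)
  also have "\<dots> = 1" using scaling_norm[OF j] by (simp add: set_lebesgue_integral_def)
  finally show ?thesis
    using set_integral_norm_bound[OF int\<Phi>] by simp
qed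

text \<open>Scaling coefficients stay those of the constant 1, and apart from \<open>d\<close> at
  \<open>(l, k)\<close> all wavelet coefficients vanish; \<open>small\<close> gives nonnegativity.
  The second integral is the second moment of the likelihood ratio for a single observation.\<close>

lemma
  assumes lk: "(l, k) \<in> wavelet_index J0" and cont: "continuous_on {0..1} (\<Psi> l k)"
    and B: "1 \<le> B" and d: "0 \<le> d" "2 powr (real l * (r + 1 / 2)) * d \<le> B"
    and small: "\<And>x. x \<in> {0..1} \<Longrightarrow> d * \<bar>\<Psi> l k x\<bar> \<le> 1"
  shows perturbed_uniform_density: "(\<lambda>x. 1 + d * \<Psi> l k x) \<in> hoelder_densities J0 \<Phi> \<Psi> r B"
    and perturbed_uniform_density_square: "(LINT x:{0..1}|lborel. (1 + d * \<Psi> l k x)\<^sup>2) = 1 + d\<^sup>2"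
proof -
  let ?A = "{0..1} :: real set"
  let ?f = "\<lambda>x. 1 + d * \<Psi> l k x"
  \<comment> \<open>All integrals below are instances of this identity: \<open>g\<close> is 1, a
    basis function or \<open>?f\<close> itself.\<close>
  have inner: "(LINT x:?A|lborel. ?f x * g x)
      = (LINT x:?A|lborel. g x) + d * (LINT x:?A|lborel. \<Psi> l k x * g x)" if g: "L2_on ?A g" for g
  proof -
    have "set_integrable lborel ?A g"
      using L2_on_set_integrable_mult[OF continuous_on_L2_on_Icc[of 0 1 "\<lambda>x. 1"] g] by simp
    moreover have "set_integrable lborel ?A (\<lambda>x. d * (\<Psi> l k x * g x))"
      by (intro set_integrable_mult_right L2_on_set_integrable_mult[OF wavelet_L2[OF lk] g])
    ultimately have "(LINT x:?A|lborel. g x + d * (\<Psi> l k x * g x))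
        = (LINT x:?A|lborel. g x) + (LINT x:?A|lborel. d * (\<Psi> l k x * g x))"
      by (rule set_integral_add(2))
    then show ?thesis by (simp add: algebra_simps)
  qed
  have L2_1: "L2_on ?A (\<lambda>x. 1)" by (intro continuous_on_L2_on_Icc continuous_on_const)
  have int_1: "(LINT x:?A|lborel. (1 :: real)) = 1" by (simp add: set_lebesgue_integral_def)
  have int_f: "(LINT x:?A|lborel. ?f x) = 1"
    using inner[OF L2_1] wavelet_integral_zero[OF lk] int_1 by simp
  have scaling: "\<bar>LINT x:?A|lborel. ?f x * \<Phi> j x\<bar> \<le> B" if j: "j \<in> {1..2 ^ J0}" for j
    using inner[OF scaling_L2[OF j]] wavelet_scaling_orthogonal[OF lk j] scaling_integral_le_1[OF j] B
    by simp
  have wavelet: "2 powr (real l' * (r + 1 / 2)) * \<bar>LINT x:?A|lborel. ?f x * \<Psi> l' k' x\<bar> \<le> B"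
    if l'k': "(l', k') \<in> wavelet_index J0" for l' k'
    using inner[OF wavelet_L2[OF l'k']] wavelet_orthonormal[OF lk l'k'] wavelet_integral_zero[OF l'k'] B d
    by auto
  have "hoelder_norm J0 \<Phi> \<Psi> r ?f \<le> ennreal B"
    unfolding hoelder_norm_def using scaling wavelet
    by (intro max.boundedI SUP_least) (auto intro!: ennreal_leI)
  moreover have "0 \<le> ?f x" if "x \<in> ?A" for x
    using small[OF that] d(1) by (simp add: abs_if split: if_splits)
  moreover have cont_f: "continuous_on ?A ?f" using cont by (intro continuous_intros)
  ultimately show "?f \<in> hoelder_densities J0 \<Phi> \<Psi> r B"
    using int_f by (auto simp: hoelder_densities_def)
  have "(LINT x:?A|lborel. ?f x * ?f x) = 1 + d * (LINT x:?A|lborel. ?f x * \<Psi> l k x)"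
    using inner[OF continuous_on_L2_on_Icc[OF cont_f]] int_f by (simp add: mult.commute)
  also have "\<dots> = 1 + d\<^sup>2"
    using inner[OF wavelet_L2[OF lk]] wavelet_orthonormal[OF lk lk] wavelet_integral_zero[OF lk]
    by (simp add: power2_eq_square)
  finally show "(LINT x:?A|lborel. (?f x)\<^sup>2) = 1 + d\<^sup>2" by (simp add: power2_eq_square)
qed

text \<open>The constants come from the basis alone and are fixed before \<open>r\<close> and
  \<open>B\<close>. \<open>K\<close> bounds \<open>\<psi>\<close> and keeps the perturbed densities
  nonnegative; \<open>\<eta>\<close> is the modulus of a nonzero value of \<open>\<psi>\<close> and
  measures the separation.\<close>

lemma separated_hoelder_densities:
  obtains N :: nat and \<eta> K :: real and l0 :: nat where "0 < N" "0 < \<eta>" "0 < K"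
    "\<And>l r B. l0 \<le> l \<Longrightarrow> 1 \<le> B \<Longrightarrow> B * K * 2 powr (- real l * r) \<le> 1 \<Longrightarrow>
      \<exists>f :: nat \<Rightarrow> real \<Rightarrow> real.
        (\<forall>i<2 ^ l div (4 * N). f i \<in> hoelder_densities J0 \<Phi> \<Psi> r B \<and>
           (LINT x:{0..1}|lborel. (f i x)\<^sup>2) = 1 + (B * 2 powr (- real l * (r + 1 / 2)))\<^sup>2) \<and>
        (\<forall>i<2 ^ l div (4 * N). \<forall>j<2 ^ l div (4 * N). i \<noteq> j \<longrightarrow>
           (\<exists>y\<in>{0..1}. B * \<eta> * 2 powr (- real l * r) \<le> \<bar>f i y - f j y\<bar>))"
proof -
  obtain N \<psi> c where N: "1 \<le> N" "2 * N \<le> 2 ^ J0" and cont: "continuous_on UNIV \<psi>"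
    and supp: "\<And>x. x \<notin> {1 - real N..real N} \<Longrightarrow> \<psi> x = 0"
    and \<Psi>: "\<And>l k x. J0 \<le> l \<Longrightarrow> N < k \<Longrightarrow> k \<le> 2 ^ l - N \<Longrightarrow> x \<in> {0..1} \<Longrightarrow>
       \<Psi> l k x = 2 powr (real l / 2) * \<psi> (2 ^ l * x - real (k - 1))"
    and c: "\<And>x. x \<in> {0..1} \<Longrightarrow> (\<Sum>k\<in>{1..2 ^ J0}. c k * \<Phi> k x) = 1"
    by (rule daubechies_basis_interior[OF basis S]) (rule that; assumption)
  obtain K where K: "0 < K" "\<And>x. \<bar>\<psi> x\<bar> \<le> K"
    using bounded_continuous_compact_support[OF cont supp] by blast
  \<comment> \<open>One level above \<open>J0\<close> gives \<open>2 ^ l \<ge> 4 * N\<close>, so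
    that index \<open>N + 1\<close> is interior.\<close>
  define l0 where "l0 = J0 + 1"
  have interior: "(l, k) \<in> wavelet_index J0" if "l0 \<le> l" "N < k" "k \<le> 2 ^ l - N" for l k
    using that by (auto simp: wavelet_index_def l0_def)
  \<comment> \<open>If \<open>\<psi>\<close> vanished identically, so would an interior wavelet,
    against its unit norm.\<close>
  obtain y0 where y0: "\<psi> y0 \<noteq> 0"
  proof (rule ccontr)
    assume "\<not> thesis"
    then have zero: "\<psi> x = 0" for x using that by blast
    have k: "N < N + 1" "N + 1 \<le> 2 ^ l0 - N" using N by (auto simp: l0_def)
    have "\<Psi> l0 (N + 1) x = 0" if "x \<in> {0..1}" for x
      using \<Psi>[of l0 "N + 1" x] k that by (simp add: zero l0_def)
    then have "(LINT x:{0..1}|lborel. \<Psi> l0 (N + 1) x * \<Psi> l0 (N + 1) x) = (LINT x:{0..1 :: real}|lborel. 0 :: real)"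
      by (intro set_lebesgue_integral_cong) auto
    then show False using wavelet_orthonormal[OF interior interior, OF _ k _ k] by simp
  qed
  then have y0_in: "y0 \<in> {1 - real N..real N}" using supp by blast
  show thesis
  proof (rule that[of N "\<bar>\<psi> y0\<bar>" K l0])
    fix l :: nat and r B :: real
    assume l: "l0 \<le> l" and B: "1 \<le> B" and small: "B * K * 2 powr (- real l * r) \<le> 1"
    define M :: nat where "M = 2 ^ l div (4 * N)"
    define d where "d = B * 2 powr (- real l * (r + 1 / 2))"
    \<comment> \<open>The indices start at the first interior one, and the step \<open>2 * N\<close>
      exceeds the support length \<open>2 * N - 1\<close> of \<open>\<psi>\<close>. The quotient in
      \<open>M\<close> keeps them clear of the right edge functions.\<close>
    define k where "k i = N + 1 + 2 * N * i" for i
    have exponent: "- real l * (r + 1 / 2) + real l / 2 = - real l * r" by (simp add: field_simps)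
    have d: "0 \<le> d" "2 powr (real l * (r + 1 / 2)) * d = B"
      using B by (simp_all add: d_def powr_minus)
    have d_height: "d * 2 powr (real l / 2) = B * 2 powr (- real l * r)"
      unfolding d_def mult.assoc powr_add[symmetric] exponent ..
    have NM: "2 * (2 * N * M) \<le> 2 ^ l"
      unfolding M_def using times_div_less_eq_dividend[of "4 * N" "2 ^ l"] by (simp add: mult.assoc)
    have Ni: "2 * N * i + 2 * N \<le> 2 * N * M" if "i < M" for i
    proof -
      have "2 * N * (i + 1) \<le> 2 * N * M" using that by (intro mult_left_mono) auto
      then show ?thesis by simp
    qed
    have "(2 :: nat) \<le> 2 ^ l" using l power_increasing[of 1 l "2 :: nat"] by (simp add: l0_def)
    then have k: "N < k i" "k i \<le> 2 ^ l - N" if "i < M" for i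
      using NM Ni[OF that] N(1) by (auto simp: k_def)
    have \<Psi>k: "\<Psi> l (k i) x = 2 powr (real l / 2) * \<psi> (2 ^ l * x - real (N + 2 * N * i))"
      if "i < M" "x \<in> {0..1}" for i x
      using \<Psi>[OF _ k(1)[OF that(1)] k(2)[OF that(1)] that(2)] l by (simp add: k_def l0_def)
    have in_class: "(\<lambda>x. 1 + d * \<Psi> l (k i) x) \<in> hoelder_densities J0 \<Phi> \<Psi> r B \<and>
        (LINT x:{0..1}|lborel. (1 + d * \<Psi> l (k i) x)\<^sup>2) = 1 + d\<^sup>2" if i: "i < M" for i
    proof -
      have "continuous_on {0..1} (\<lambda>x. 2 powr (real l / 2) * \<psi> (2 ^ l * x - real (N + 2 * N * i)))"
        by (intro continuous_intros continuous_on_compose2[OF cont]) auto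
      then have "continuous_on {0..1} (\<Psi> l (k i))"
        by (rule continuous_on_eq) (simp add: \<Psi>k[OF i])
      moreover have "d * \<bar>\<Psi> l (k i) x\<bar> \<le> 1" if x: "x \<in> {0..1}" for x
      proof -
        let ?z = "2 ^ l * x - real (N + 2 * N * i)"
        have "d * \<bar>\<Psi> l (k i) x\<bar> = (d * 2 powr (real l / 2)) * \<bar>\<psi> ?z\<bar>"
          unfolding \<Psi>k[OF i x] by (simp add: abs_mult)
        also have "\<dots> \<le> (d * 2 powr (real l / 2)) * K" using d(1) K(2) by (intro mult_left_mono) auto
        also have "\<dots> \<le> 1" using small unfolding d_height by (simp add: mult_ac)
        finally show ?thesis .
      qed
      ultimately show ?thesis
        using perturbed_uniform_density[OF interior[OF l k[OF i]] _ B d(1), where r = r]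
          perturbed_uniform_density_square[OF interior[OF l k[OF i]] _ B d(1), where r = r] d(2)
        by simp
    qed
    have sep: "\<exists>y\<in>{0..1}. B * \<bar>\<psi> y0\<bar> * 2 powr (- real l * r)
        \<le> \<bar>(1 + d * \<Psi> l (k i) y) - (1 + d * \<Psi> l (k j) y)\<bar>" if ij: "i < M" "j < M" "i \<noteq> j" for i j
    proof
      \<comment> \<open>At this point the argument of the \<open>i\<close>-th wavelet is
        \<open>y0\<close>, while that of the \<open>j\<close>-th is displaced by a nonzero multiple
        of \<open>2 * N\<close> and leaves the support.\<close>
      define y where "y = (y0 + real (N + 2 * N * i)) / 2 ^ l"
      have ly: "2 ^ l * y = y0 + real (N + 2 * N * i)" by (simp add: y_def)
      have "2 * N * i + 2 * N \<le> 2 ^ l" using Ni[OF ij(1)] NM by linarith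
      moreover define a where "a = real (N + 2 * N * i)"
      ultimately have "a + real N \<le> 2 ^ l"
        by (simp add: a_def add.commute flip: of_nat_add of_nat_mult of_nat_power)
      moreover have "real N \<le> a" by (simp add: a_def)
      ultimately have "0 \<le> y0 + a" "y0 + a \<le> 2 ^ l" using y0_in by auto
      then show y: "y \<in> {0..1}" by (simp add: y_def a_def)
      have "y0 + 2 * real N * (real i - real j) \<notin> {1 - real N..real N}"
      proof (cases "i < j")
        case True
        then have "2 * real N * 1 \<le> 2 * real N * (real j - real i)" by (intro mult_left_mono) auto
        then show ?thesis using y0_in by (auto simp: algebra_simps)
      next
        case False
        then have "2 * real N * 1 \<le> 2 * real N * (real i - real j)" using ij by (intro mult_left_mono) auto
        then show ?thesis using y0_in by (auto simp: algebra_simps)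
      qed
      moreover have "2 ^ l * y - real (N + 2 * N * j) = y0 + 2 * real N * (real i - real j)"
        unfolding ly by (simp add: algebra_simps)
      ultimately have "\<psi> (2 ^ l * y - real (N + 2 * N * j)) = 0" using supp by simp
      then have "\<Psi> l (k j) y = 0" using \<Psi>k[OF ij(2) y] by simp
      moreover have "d * \<Psi> l (k i) y = B * 2 powr (- real l * r) * \<psi> y0"
        unfolding \<Psi>k[OF ij(1) y] ly d_height[symmetric] by simp
      ultimately show "B * \<bar>\<psi> y0\<bar> * 2 powr (- real l * r)
          \<le> \<bar>(1 + d * \<Psi> l (k i) y) - (1 + d * \<Psi> l (k j) y)\<bar>"
        using B by (simp add: abs_mult mult_ac)
    qed
    show "\<exists>f :: nat \<Rightarrow> real \<Rightarrow> real.
        (\<forall>i<2 ^ l div (4 * N). f i \<in> hoelder_densities J0 \<Phi> \<Psi> r B \<and>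
           (LINT x:{0..1}|lborel. (f i x)\<^sup>2) = 1 + (B * 2 powr (- real l * (r + 1 / 2)))\<^sup>2) \<and>
        (\<forall>i<2 ^ l div (4 * N). \<forall>j<2 ^ l div (4 * N). i \<noteq> j \<longrightarrow>
           (\<exists>y\<in>{0..1}. B * \<bar>\<psi> y0\<bar> * 2 powr (- real l * r) \<le> \<bar>f i y - f j y\<bar>))"
      using in_class sep unfolding M_def d_def
      by (intro exI[of _ "\<lambda>i x. 1 + d * \<Psi> l (k i) x"]) (simp add: d_def)
  qed (use N(1) y0 K(1) in auto)
qed

end

subsection \<open>Likelihood ratios and disjoint events\<close>

text \<open>Both measures agree on rectangles, where the integral of a product over separate
  coordinates factorises.\<close>

lemma PiM_density:
  fixes f :: "'i \<Rightarrow> 'a \<Rightarrow> ennreal"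
  assumes I: "finite I" and M: "product_sigma_finite M"
    and D: "product_sigma_finite (\<lambda>i. density (M i) (f i))"
    and f: "\<And>i. i \<in> I \<Longrightarrow> f i \<in> borel_measurable (M i)"
  shows "(\<Pi>\<^sub>M i\<in>I. density (M i) (f i)) = density (PiM I M) (\<lambda>x. \<Prod>i\<in>I. f i (x i))"
proof -
  interpret M: product_sigma_finite M by fact
  interpret D: product_sigma_finite "\<lambda>i. density (M i) (f i)" by fact
  have meas: "(\<lambda>x. \<Prod>i\<in>I. f i (x i)) \<in> borel_measurable (PiM I M)"
    using f by (intro borel_measurable_prod_ennreal measurable_compose[OF measurable_component_singleton]) auto
  show ?thesis
  proof (rule D.PiM_eqI[OF I, symmetric])
    show "sets (density (PiM I M) (\<lambda>x. \<Prod>i\<in>I. f i (x i))) = sets (\<Pi>\<^sub>M i\<in>I. density (M i) (f i))"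
      by (simp cong: sets_PiM_cong)
    fix A assume "\<And>i. i \<in> I \<Longrightarrow> A i \<in> sets (density (M i) (f i))"
    then have A: "\<And>i. i \<in> I \<Longrightarrow> A i \<in> sets (M i)" by simp
    have "emeasure (density (PiM I M) (\<lambda>x. \<Prod>i\<in>I. f i (x i))) (Pi\<^sub>E I A)
        = (\<integral>\<^sup>+ x. (\<Prod>i\<in>I. f i (x i)) * indicator (Pi\<^sub>E I A) x \<partial>PiM I M)"
      using A I by (intro emeasure_density meas) (auto intro: sets_PiM_I_finite)
    also have "\<dots> = (\<integral>\<^sup>+ x. (\<Prod>i\<in>I. f i (x i) * indicator (A i) (x i)) \<partial>PiM I M)"
    proof (rule nn_integral_cong)
      fix x assume "x \<in> space (PiM I M)"
      then have "x \<in> Pi\<^sub>E I A \<longleftrightarrow> (\<forall>i\<in>I. x i \<in> A i)"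
        by (auto simp: space_PiM PiE_iff)
      then show "(\<Prod>i\<in>I. f i (x i)) * indicator (Pi\<^sub>E I A) x
          = (\<Prod>i\<in>I. f i (x i) * indicator (A i) (x i))"
        using I by (auto simp: indicator_def prod.distrib intro!: prod_zero[symmetric])
    qed
    also have "\<dots> = (\<Prod>i\<in>I. \<integral>\<^sup>+ x. f i x * indicator (A i) x \<partial>M i)"
      using f A by (intro M.product_nn_integral_prod[OF I]) auto
    also have "\<dots> = (\<Prod>i\<in>I. emeasure (density (M i) (f i)) (A i))"
      using f A by (intro prod.cong refl) (simp add: emeasure_density)
    finally show "emeasure (density (PiM I M) (\<lambda>x. \<Prod>i\<in>I. f i (x i))) (Pi\<^sub>E I A)
        = (\<Prod>i\<in>I. emeasure (density (M i) (f i)) (A i))" .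
  qed
qed

text \<open>Expands the nonnegative square of \<open>u - t\<close>. With its free parameter
  \<open>t\<close> this replaces Cauchy-Schwarz and avoids square roots; for infinite
  \<open>u\<close> the right side is infinite too.\<close>

lemma ennreal_le_amgm_square:
  fixes u :: ennreal
  assumes "0 < t"
  shows "u \<le> ennreal (t / 2) + ennreal (1 / (2 * t)) * u\<^sup>2"
proof (cases u)
  case (real x)
  have "0 \<le> (x - t)\<^sup>2 / (2 * t)" using assms by simp
  also have "\<dots> = t / 2 + 1 / (2 * t) * x\<^sup>2 - x"
    using assms by (simp add: power2_eq_square field_simps)
  finally have "x \<le> t / 2 + 1 / (2 * t) * x\<^sup>2" by simp
  then show ?thesis
    using real assms by (simp add: ennreal_power flip: ennreal_plus ennreal_mult)
next
  case top
  then show ?thesis using assms by (simp add: ennreal_mult_top)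
qed

text \<open>The preceding inequality is applied to \<open>L k\<close> on \<open>A k\<close>. By
  disjointness the first terms contribute at most \<open>t / 2\<close> in total, whatever the size
  of \<open>K\<close>; the second terms are controlled by the second moments.\<close>

lemma sum_disjoint_events_density_le:
  assumes M: "prob_space M" and K: "finite K" and disj: "disjoint_family_on A K" and t: "0 < t"
    and A: "\<And>k. k \<in> K \<Longrightarrow> A k \<in> sets M"
    and L: "\<And>k. k \<in> K \<Longrightarrow> L k \<in> borel_measurable M"
    and V: "\<And>k. k \<in> K \<Longrightarrow> (\<integral>\<^sup>+ x. (L k x)\<^sup>2 \<partial>M) \<le> ennreal V" "0 \<le> V"
  shows "(\<Sum>k\<in>K. emeasure (density M (L k)) (A k)) \<le> ennreal (t / 2 + real (card K) * V / (2 * t))"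
proof -
  interpret prob_space M by fact
  have "emeasure (density M (L k)) (A k) \<le> ennreal (t / 2) * emeasure M (A k) + ennreal (V / (2 * t))"
    if k: "k \<in> K" for k
  proof -
    have "emeasure (density M (L k)) (A k) = (\<integral>\<^sup>+ x. L k x * indicator (A k) x \<partial>M)"
      using k A L by (simp add: emeasure_density)
    also have "\<dots> \<le> (\<integral>\<^sup>+ x. ennreal (t / 2) * indicator (A k) x + ennreal (1 / (2 * t)) * (L k x)\<^sup>2 \<partial>M)"
      using ennreal_le_amgm_square[OF t] by (intro nn_integral_mono) (simp add: indicator_def)
    also have "\<dots> = ennreal (t / 2) * emeasure M (A k) + ennreal (1 / (2 * t)) * (\<integral>\<^sup>+ x. (L k x)\<^sup>2 \<partial>M)"
      using k A[OF k] L[OF k] by (simp add: nn_integral_add nn_integral_cmult nn_integral_cmult_indicator)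
    also have "\<dots> \<le> ennreal (t / 2) * emeasure M (A k) + ennreal (1 / (2 * t)) * ennreal V"
      using V(1)[OF k] by (intro add_left_mono mult_left_mono) auto
    also have "ennreal (1 / (2 * t)) * ennreal V = ennreal (V / (2 * t))"
      using t V(2) by (simp flip: ennreal_mult)
    finally show ?thesis .
  qed
  then have "(\<Sum>k\<in>K. emeasure (density M (L k)) (A k))
      \<le> (\<Sum>k\<in>K. ennreal (t / 2) * emeasure M (A k) + ennreal (V / (2 * t)))"
    by (rule sum_mono)
  also have "\<dots> = ennreal (t / 2) * emeasure M (\<Union>k\<in>K. A k) + of_nat (card K) * ennreal (V / (2 * t))"
    using A K disj
    by (subst sum_emeasure[symmetric]) (auto simp: sum.distrib sum_distrib_left)
  also have "\<dots> \<le> ennreal (t / 2) * 1 + of_nat (card K) * ennreal (V / (2 * t))"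
    by (intro add_right_mono mult_left_mono emeasure_le_1) auto
  also have "\<dots> = ennreal (t / 2 + real (card K) * V / (2 * t))"
    using t V(2) by (simp add: ennreal_of_nat_eq_real_of_nat flip: ennreal_mult ennreal_plus)
  finally show ?thesis .
qed

section \<open>The uniform law on the unit interval and the law of the sample\<close>

abbreviation unit_lborel :: "real measure" where
  "unit_lborel \<equiv> restrict_space lborel {0..1}"

lemma prob_space_unit_lborel: "prob_space unit_lborel"
  by (intro prob_spaceI) (simp add: space_restrict_space emeasure_restrict_space)

lemma continuous_on_measurable_unit_lborel:
  fixes f :: "real \<Rightarrow> real"
  assumes "continuous_on {0..1} f"
  shows "(\<lambda>x. ennreal (f x)) \<in> borel_measurable unit_lborel"
proof -
  have "f \<in> borel_measurable (restrict_space borel {0..1})"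
    using assms by (rule borel_measurable_continuous_on_restrict)
  then have "f \<in> borel_measurable unit_lborel"
    by (simp cong: measurable_cong_sets add: measurable_restrict_space1 sets_restrict_space)
  then show ?thesis by measurable
qed

lemma nn_integral_unit_lborel:
  fixes f :: "real \<Rightarrow> real"
  assumes f: "continuous_on {0..1} f" "\<And>x. x \<in> {0..1} \<Longrightarrow> 0 \<le> f x"
  shows "(\<integral>\<^sup>+ x. ennreal (f x) \<partial>unit_lborel) = ennreal (LINT x:{0..1}|lborel. f x)"
proof -
  have "integrable unit_lborel f"
    using borel_integrable_atLeastAtMost'[OF f(1)] by (simp flip: set_integrable_eq)
  then have "(\<integral>\<^sup>+ x. ennreal (f x) \<partial>unit_lborel) = ennreal (LINT x|unit_lborel. f x)"
    using f(2) by (intro nn_integral_eq_integral) (auto simp: space_restrict_space intro!: AE_I2)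
  then show ?thesis by (simp add: integral_restrict_space set_lebesgue_integral_def)
qed

lemma sets_sample_law: "sets (sample_law n f) = sets (sample_space n)"
  unfolding sample_law_def sample_space_def
  by (intro sets_PiM_cong) (simp_all add: sets_restrict_space)

lemma sample_law_eq_density:
  assumes f: "continuous_on {0..1} f" "\<And>x. x \<in> {0..1} \<Longrightarrow> 0 \<le> f x" "(LINT x:{0..1}|lborel. f x) = 1"
  shows "sample_law n f
    = density (\<Pi>\<^sub>M i\<in>{1..n}. unit_lborel) (\<lambda>X. \<Prod>i\<in>{1..n}. ennreal (f (X i)))"
proof -
  interpret U: prob_space unit_lborel by (rule prob_space_unit_lborel)
  have "emeasure (density unit_lborel (\<lambda>x. ennreal (f x))) (space unit_lborel)
      = (\<integral>\<^sup>+ x. ennreal (f x) * indicator (space unit_lborel) x \<partial>unit_lborel)"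
    by (intro emeasure_density continuous_on_measurable_unit_lborel[OF f(1)] sets.top)
  also have "\<dots> = (\<integral>\<^sup>+ x. ennreal (f x) \<partial>unit_lborel)"
    by (intro nn_integral_cong) simp
  also have "\<dots> = 1" using nn_integral_unit_lborel[OF f(1,2)] f(3) by simp
  finally interpret D: prob_space "density unit_lborel (\<lambda>x. ennreal (f x))"
    by (intro prob_spaceI) (simp only: space_density)
  show ?thesis unfolding sample_law_def
    using continuous_on_measurable_unit_lborel[OF f(1)]
    by (intro PiM_density) (auto simp: product_sigma_finite_def U.sigma_finite_measure_axioms D.sigma_finite_measure_axioms)
qed

lemma set_lebesgue_integral_nonneg:
  fixes f :: "'a \<Rightarrow> real"
  assumes "\<And>x. x \<in> A \<Longrightarrow> 0 \<le> f x"
  shows "0 \<le> (LINT x:A|M. f x)"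
  unfolding set_lebesgue_integral_def
  using assms by (intro Bochner_Integration.integral_nonneg) (auto simp: indicator_def)

text \<open>The coordinates are independent under the uniform law, so the second moment
  factorises.\<close>

lemma nn_integral_likelihood_square:
  assumes f: "continuous_on {0..1} f" "\<And>x. x \<in> {0..1} \<Longrightarrow> 0 \<le> f x"
  shows "(\<integral>\<^sup>+ X. (\<Prod>i\<in>{1..n}. ennreal (f (X i)))\<^sup>2 \<partial>(\<Pi>\<^sub>M i\<in>{1..n}. unit_lborel))
    = ennreal ((LINT x:{0..1}|lborel. (f x)\<^sup>2) ^ n)"
proof -
  interpret U: prob_space unit_lborel by (rule prob_space_unit_lborel)
  interpret P: product_sigma_finite "\<lambda>i :: nat. unit_lborel"
    by (simp add: product_sigma_finite_def U.sigma_finite_measure_axioms)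
  have "(\<integral>\<^sup>+ X. (\<Prod>i\<in>{1..n}. ennreal (f (X i)))\<^sup>2 \<partial>(\<Pi>\<^sub>M i\<in>{1..n}. unit_lborel))
      = (\<integral>\<^sup>+ X. (\<Prod>i\<in>{1..n}. (ennreal (f (X i)))\<^sup>2) \<partial>(\<Pi>\<^sub>M i\<in>{1..n}. unit_lborel))"
    by (simp add: prod_power_distrib)
  also have "\<dots> = (\<Prod>i\<in>{1..n}. \<integral>\<^sup>+ x. (ennreal (f x))\<^sup>2 \<partial>unit_lborel)"
    using continuous_on_measurable_unit_lborel[OF f(1)]
    by (intro P.product_nn_integral_prod) auto
  also have "(\<integral>\<^sup>+ x. (ennreal (f x))\<^sup>2 \<partial>unit_lborel) = (\<integral>\<^sup>+ x. ennreal ((f x)\<^sup>2) \<partial>unit_lborel)"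
    using f(2) by (intro nn_integral_cong) (simp add: space_restrict_space ennreal_power)
  also have "\<dots> = ennreal (LINT x:{0..1}|lborel. (f x)\<^sup>2)"
    using f(1) by (intro nn_integral_unit_lborel continuous_on_power) auto
  also have "(\<Prod>i\<in>{1..n}. ennreal (LINT x:{0..1}|lborel. (f x)\<^sup>2)) = ennreal ((LINT x:{0..1}|lborel. (f x)\<^sup>2) ^ n)"
    by (simp add: ennreal_power set_lebesgue_integral_nonneg)
  finally show ?thesis .
qed

section \<open>Coverage probability against expected diameter\<close>

lemma covered_functions_close:
  assumes "X \<in> cover_event lo up n f" and "X \<in> cover_event lo up n g" and "y \<in> {0..1}"
  shows "ennreal \<bar>f y - g y\<bar> \<le> diameter_band lo up n X"
proof -
  have "\<bar>f y - g y\<bar> \<le> \<bar>up n X y - lo n X y\<bar>"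
    using assms unfolding cover_event_def by fastforce
  then show ?thesis
    unfolding diameter_band_def using assms(3) by (meson SUP_upper2 ennreal_leI)
qed

text \<open>Each coverage event is split by whether the diameter reaches \<open>s\<close>. Markov's
  inequality bounds the part where it does by \<open>D / s\<close>; the remaining parts are disjoint
  for different \<open>k\<close>, so their average probability is small.\<close>

lemma coverage_le_expected_diameter:
  fixes f :: "'k \<Rightarrow> real \<Rightarrow> real"
  assumes K: "finite K" "K \<noteq> {}"
    and f: "\<And>k. k \<in> K \<Longrightarrow> continuous_on {0..1} (f k)"
      "\<And>k x. k \<in> K \<Longrightarrow> x \<in> {0..1} \<Longrightarrow> 0 \<le> f k x"
      "\<And>k. k \<in> K \<Longrightarrow> (LINT x:{0..1}|lborel. f k x) = 1"
      "\<And>k. k \<in> K \<Longrightarrow> (LINT x:{0..1}|lborel. (f k x)\<^sup>2) \<le> v"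
    and sep: "\<And>j k. j \<in> K \<Longrightarrow> k \<in> K \<Longrightarrow> j \<noteq> k \<Longrightarrow> \<exists>y\<in>{0..1}. s \<le> \<bar>f j y - f k y\<bar>"
    and s: "0 < s" and \<epsilon>: "0 < \<epsilon>"
    and diam: "diameter_band lo up n \<in> borel_measurable (sample_space n)"
    and cover: "\<And>k. k \<in> K \<Longrightarrow> cover_event lo up n (f k) \<in> sets (sample_space n)"
    and q: "\<And>k. k \<in> K \<Longrightarrow> q \<le> emeasure (sample_law n (f k)) (cover_event lo up n (f k))"
    and D: "\<And>k. k \<in> K \<Longrightarrow> (\<integral>\<^sup>+ X. diameter_band lo up n X \<partial>sample_law n (f k)) \<le> D"
  shows "q \<le> ennreal (\<epsilon> / 2 + v ^ n / (2 * \<epsilon> * real (card K))) + ennreal (1 / s) * D"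
proof -
  let ?U = "\<Pi>\<^sub>M i\<in>{1..n}. unit_lborel"
  let ?L = "\<lambda>k X. \<Prod>i\<in>{1..n}. ennreal (f k (X i))"
  let ?d = "diameter_band lo up n"
  define S where "S = sample_space n"
  \<comment> \<open>The condition \<open>s \<le> ?d X\<close>, written in the form of Markov's
    inequality.\<close>
  define G where "G = {X \<in> space S. 1 \<le> ennreal (1 / s) * ?d X}"
  define A where "A k = cover_event lo up n (f k) - G" for k
  have [measurable]: "?d \<in> borel_measurable S" using diam by (simp add: S_def)
  have [measurable]: "G \<in> sets S" unfolding G_def by measurable
  have sets_law: "sets (sample_law n (f k)) = sets S" for k
    by (simp add: sets_sample_law S_def)
  have law: "sample_law n (f k) = density ?U (?L k)" if "k \<in> K" for k
    using f[OF that] by (intro sample_law_eq_density)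
  have sets_U: "sets ?U = sets S"
    unfolding S_def sample_space_def by (intro sets_PiM_cong) (simp_all add: sets_restrict_space)
  have v: "0 \<le> v"
  proof -
    obtain k where "k \<in> K" using K(2) by blast
    have "0 \<le> (LINT x:{0..1}|lborel. (f k x)\<^sup>2)" by (intro set_lebesgue_integral_nonneg) auto
    then show ?thesis using f(4)[OF \<open>k \<in> K\<close>] by linarith
  qed
  have disj: "disjoint_family_on A K"
  proof (unfold disjoint_family_on_def, intro ballI impI)
    fix j k assume jk: "j \<in> K" "k \<in> K" "j \<noteq> k"
    obtain y where y: "y \<in> {0..1}" "s \<le> \<bar>f j y - f k y\<bar>" using sep[OF jk] by blast
    have "X \<in> G" if X: "X \<in> cover_event lo up n (f j)" "X \<in> cover_event lo up n (f k)" for X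
    proof -
      have "ennreal s \<le> ?d X"
        using covered_functions_close[OF X y(1)] ennreal_leI[OF y(2)] by (rule order_trans[rotated])
      then have "ennreal (1 / s) * ennreal s \<le> ennreal (1 / s) * ?d X"
        by (intro mult_left_mono) auto
      moreover have "ennreal (1 / s) * ennreal s = 1" using s by (simp flip: ennreal_mult)
      moreover have "X \<in> space S" using X by (simp add: cover_event_def S_def)
      ultimately show ?thesis by (simp add: G_def)
    qed
    then show "A j \<inter> A k = {}" by (auto simp: A_def)
  qed
  have A: "A k \<in> sets S" if "k \<in> K" for k
    using cover[OF that] unfolding A_def S_def[symmetric] by (auto simp: \<open>G \<in> sets S\<close>)
  have tail: "emeasure (sample_law n (f k)) G \<le> ennreal (1 / s) * D" if "k \<in> K" for k
  proof -
    have [measurable]: "?d \<in> borel_measurable (sample_law n (f k))"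
      using diam by (simp cong: measurable_cong_sets add: sets_law S_def)
    have sp: "space (sample_law n (f k)) = space S" by (rule sets_eq_imp_space_eq[OF sets_law])
    have "emeasure (sample_law n (f k)) G
        \<le> ennreal (1 / s) * (\<integral>\<^sup>+ X. ?d X * indicator (space S) X \<partial>sample_law n (f k))"
      unfolding G_def by (rule nn_integral_Markov_inequality) (simp_all add: sp[symmetric])
    also have "(\<integral>\<^sup>+ X. ?d X * indicator (space S) X \<partial>sample_law n (f k))
        = (\<integral>\<^sup>+ X. ?d X \<partial>sample_law n (f k))"
      by (intro nn_integral_cong) (simp add: sp)
    also have "\<dots> \<le> D" by (rule D[OF that])
    finally show ?thesis by (simp add: mult_left_mono)
  qed
  have "of_nat (card K) * q \<le> (\<Sum>k\<in>K. emeasure (sample_law n (f k)) (cover_event lo up n (f k)))"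
    using q by (simp add: sum_bounded_below)
  also have "\<dots> \<le> (\<Sum>k\<in>K. emeasure (sample_law n (f k)) (A k) + ennreal (1 / s) * D)"
  proof (rule sum_mono)
    fix k assume k: "k \<in> K"
    have "emeasure (sample_law n (f k)) (cover_event lo up n (f k))
        \<le> emeasure (sample_law n (f k)) (A k \<union> G)"
    proof (rule emeasure_mono)
      show "cover_event lo up n (f k) \<subseteq> A k \<union> G" by (auto simp: A_def)
      show "A k \<union> G \<in> sets (sample_law n (f k))"
        unfolding sets_law using A[OF k] \<open>G \<in> sets S\<close> by (rule sets.Un)
    qed
    also have "\<dots> \<le> emeasure (sample_law n (f k)) (A k) + emeasure (sample_law n (f k)) G"
      using A[OF k] by (intro emeasure_subadditive) (auto simp: sets_law)
    also have "\<dots> \<le> emeasure (sample_law n (f k)) (A k) + ennreal (1 / s) * D"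
      using tail[OF k] by (rule add_left_mono)
    finally show "emeasure (sample_law n (f k)) (cover_event lo up n (f k))
        \<le> emeasure (sample_law n (f k)) (A k) + ennreal (1 / s) * D" .
  qed
  also have "\<dots> = (\<Sum>k\<in>K. emeasure (density ?U (?L k)) (A k)) + of_nat (card K) * (ennreal (1 / s) * D)"
    by (simp add: sum.distrib law)
  \<comment> \<open>Here \<open>t = \<epsilon> * card K\<close>; division by \<open>card K\<close>
    then turns the two terms into \<open>\<epsilon> / 2\<close> and
    \<open>v ^ n / (2 * \<epsilon> * card K)\<close>.\<close>
  also have "(\<Sum>k\<in>K. emeasure (density ?U (?L k)) (A k))
      \<le> ennreal (\<epsilon> * real (card K) / 2 + real (card K) * v ^ n / (2 * (\<epsilon> * real (card K))))"
  proof (rule sum_disjoint_events_density_le[OF _ K(1) disj])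
    show "prob_space ?U" by (intro prob_space_PiM prob_space_unit_lborel)
    show "0 < \<epsilon> * real (card K)" using K \<epsilon> by (simp add: card_gt_0_iff)
    fix k assume k: "k \<in> K"
    show "A k \<in> sets ?U" using A[OF k] sets_U by simp
    show "?L k \<in> borel_measurable ?U"
      using continuous_on_measurable_unit_lborel[OF f(1)[OF k]]
      by (intro borel_measurable_prod_ennreal measurable_compose[OF measurable_component_singleton]) auto
    have "(LINT x:{0..1}|lborel. (f k x)\<^sup>2) ^ n \<le> v ^ n"
      using f(4)[OF k] by (intro power_mono set_lebesgue_integral_nonneg) auto
    then show "(\<integral>\<^sup>+ X. (?L k X)\<^sup>2 \<partial>?U) \<le> ennreal (v ^ n)"
      using f(1,2)[OF k] by (subst nn_integral_likelihood_square) (auto intro: ennreal_leI)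
  qed (use v in simp)
  also have "ennreal (\<epsilon> * real (card K) / 2 + real (card K) * v ^ n / (2 * (\<epsilon> * real (card K))))
      = of_nat (card K) * ennreal (\<epsilon> / 2 + v ^ n / (2 * \<epsilon> * real (card K)))"
    using K \<epsilon> v by (simp add: ennreal_of_nat_eq_real_of_nat algebra_simps flip: ennreal_mult)
  finally have "of_nat (card K) * q
      \<le> of_nat (card K) * (ennreal (\<epsilon> / 2 + v ^ n / (2 * \<epsilon> * real (card K))) + ennreal (1 / s) * D)"
    by (simp add: distrib_left)
  then show ?thesis
    using K by (subst (asm) ennreal_mult_le_mult_iff) (auto simp: card_gt_0_iff)
qed

subsection \<open>Choice of the level\<close>

lemma dyadic_between:
  fixes T :: real
  assumes "1 \<le> T"
  obtains l :: nat where "T \<le> 2 ^ l" and "2 ^ l \<le> 2 * T"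
proof -
  define l where "l = nat \<lceil>log 2 T\<rceil>"
  have l: "log 2 T \<le> real l" "real l < log 2 T + 1"
    using assms by (auto simp: l_def) linarith+
  have "T = 2 powr log 2 T" using assms by simp
  also have "\<dots> \<le> 2 powr real l" using l by simp
  finally have "T \<le> 2 ^ l" by (simp add: powr_realpow)
  moreover have "2 powr real l \<le> 2 powr (log 2 T + 1)" using l by simp
  then have "2 ^ l \<le> 2 * T" using assms by (simp add: powr_add powr_realpow)
  ultimately show ?thesis using that by blast
qed

lemma powr_two_level: "2 powr (- real l * a) = (2 ^ l :: real) powr (- a)"
  by (simp add: powr_powr flip: powr_realpow)

lemma level_scale_at_top:
  fixes C r :: real
  assumes "0 < C" and "0 < r"
  shows "filterlim (\<lambda>n :: nat. (C * real n / ln (real n)) powr (1 / (2 * r + 1))) at_top sequentially"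
proof -
  have "filterlim (\<lambda>n :: nat. (C * real n / ln (real n)) powr a) at_top sequentially" if "0 < a" for a
    using assms(1) that by real_asymp
  then show ?thesis using assms(2) by simp
qed

text \<open>As \<open>r < 1\<close>, the exponent \<open>1 / (2 * r + 1)\<close> exceeds
  \<open>1 / 3\<close>, hence \<open>1 / 8\<close>. So the number of perturbations outgrows the
  second moment of the likelihood ratios.\<close>

lemma eighth_root_dominated:
  fixes C r :: real
  assumes "0 < C" and "0 < r" and "r < 1"
  shows "(\<lambda>n :: nat. real n powr (1 / 8) / (C * real n / ln (real n)) powr (1 / (2 * r + 1))) \<longlonglongrightarrow> 0"
proof -
  have "(\<lambda>n :: nat. real n powr (1 / 8) / (C * real n / ln (real n)) powr (1 / 8 + b)) \<longlonglongrightarrow> 0"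
    if "0 < b" for b
    using assms(1) that by real_asymp
  moreover have "0 < 1 / (2 * r + 1) - 1 / 8" using assms(2,3) by (simp add: field_simps)
  ultimately have "(\<lambda>n :: nat. real n powr (1 / 8)
      / (C * real n / ln (real n)) powr (1 / 8 + (1 / (2 * r + 1) - 1 / 8))) \<longlonglongrightarrow> 0" by blast
  then show ?thesis by simp
qed

text \<open>\<open>T\<close> is chosen so that \<open>n * d^2\<close> is at most
  \<open>ln n / 8\<close>, and \<open>1 + x \<le> exp x\<close> gives the first bound. The second
  uses \<open>2 ^ l \<le> 2 * T\<close>: the factor \<open>B\<close> times the power of
  \<open>B\<close> inside \<open>T powr (- r)\<close> leaves
  \<open>B powr (1 / (2 * r + 1))\<close>.\<close>

lemma level_bounds:
  fixes B r :: real and n l :: nat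
  defines "T \<equiv> (8 * B\<^sup>2 * real n / ln (real n)) powr (1 / (2 * r + 1))"
  assumes B: "1 \<le> B" and r: "0 < r" and n: "2 \<le> n" and l: "T \<le> 2 ^ l" "2 ^ l \<le> 2 * T"
  shows "(1 + (B * 2 powr (- real l * (r + 1 / 2)))\<^sup>2) ^ n \<le> real n powr (1 / 8)"
    and "2 powr (- r) * 8 powr (- (r / (2 * r + 1))) * B powr (1 / (2 * r + 1)) * rate r n
      \<le> B * 2 powr (- real l * r)"
proof -
  define x where "x = 8 * B\<^sup>2 * real n / ln (real n)"
  have ln: "0 < ln (real n)" using n by simp
  have x: "0 < x" using B n ln by (simp add: x_def)
  have T: "T = x powr (1 / (2 * r + 1))" by (simp add: T_def x_def)
  have T_pos: "0 < T" using x by (simp add: T)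
  let ?d = "B * 2 powr (- real l * (r + 1 / 2))"
  have exponent: "- real l * (r + 1 / 2) + - real l * (r + 1 / 2) = - real l * (2 * r + 1)"
    by (simp add: algebra_simps)
  have "?d\<^sup>2 = B\<^sup>2 * (2 powr (- real l * (r + 1 / 2)) * 2 powr (- real l * (r + 1 / 2)))"
    by (simp add: power2_eq_square)
  also have "\<dots> = B\<^sup>2 * 2 powr (- real l * (2 * r + 1))"
    unfolding powr_add[symmetric] exponent ..
  also have "2 powr (- real l * (2 * r + 1)) \<le> T powr (- (2 * r + 1))"
    unfolding powr_two_level using T_pos l(1) r by (intro powr_mono2') auto
  also have "T powr (- (2 * r + 1)) = inverse x"
  proof -
    have "1 / (2 * r + 1) * (- (2 * r + 1)) = - 1" using r by (simp add: field_simps)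
    then show ?thesis using x by (simp add: T powr_powr powr_minus)
  qed
  finally have "real n * ?d\<^sup>2 \<le> real n * (B\<^sup>2 * inverse x)"
    using B by (simp add: mult_left_mono)
  also have "\<dots> = ln (real n) / 8" using B n ln by (simp add: x_def field_simps)
  finally have nd: "real n * ?d\<^sup>2 \<le> ln (real n) / 8" .
  have "(1 + ?d\<^sup>2) ^ n \<le> exp (?d\<^sup>2) ^ n"
    by (intro power_mono exp_ge_add_one_self) auto
  also have "\<dots> = exp (real n * ?d\<^sup>2)" by (simp add: exp_of_nat_mult)
  also have "\<dots> \<le> exp (ln (real n) / 8)" using nd by simp
  also have "\<dots> = real n powr (1 / 8)" using n by (simp add: powr_def)
  finally show "(1 + ?d\<^sup>2) ^ n \<le> real n powr (1 / 8)" .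
  define q where "q = r / (2 * r + 1)"
  have q: "1 - 2 * q = 1 / (2 * r + 1)" using r by (simp add: q_def field_simps)
  have "2 powr (- r) * (8 powr (- q) * B powr (1 - 2 * q) * rate r n) = B * (2 * T) powr (- r)"
  proof -
    have "T powr (- r) = x powr (- q)" using r by (simp add: T powr_powr q_def)
    also have "\<dots> = 8 powr (- q) * B powr (- 2 * q) * rate r n"
    proof -
      define w where "w = ln (real n) / real n"
      have w: "0 < w" using ln n by (simp add: w_def)
      have "x = 8 * (B powr 2 * inverse w)" using B by (simp add: x_def w_def field_simps)
      also have "(8 * (B powr 2 * inverse w)) powr (- q)
          = 8 powr (- q) * ((B powr 2) powr (- q) * inverse w powr (- q))"
        using w by (subst powr_mult | simp)+
      also have "(B powr 2) powr (- q) = B powr (- 2 * q)" by (simp add: powr_powr)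
      also have "inverse w powr (- q) = w powr q"
        using w by (simp add: powr_minus inverse_powr)
      also have "w powr q = rate r n" by (simp add: rate_def q_def w_def)
      finally show ?thesis by (simp add: mult.assoc)
    qed
    finally have "T powr (- r) = 8 powr (- q) * B powr (- 2 * q) * rate r n" .
    moreover have "B * B powr (- 2 * q) = B powr (1 - 2 * q)"
      using B by (simp add: powr_diff powr_minus field_simps)
    moreover have "(2 * T) powr (- r) = 2 powr (- r) * T powr (- r)"
      using T_pos by (intro powr_mult)
    ultimately show ?thesis by (metis mult.assoc mult.left_commute)
  qed
  also have "(2 * T) powr (- r) \<le> 2 powr (- real l * r)"
    unfolding powr_two_level using l(2) r T_pos by (intro powr_mono2') auto
  finally show "2 powr (- r) * 8 powr (- (r / (2 * r + 1))) * B powr (1 / (2 * r + 1)) * rate r n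
      \<le> B * 2 powr (- real l * r)"
    using B unfolding q q_def[symmetric] by (simp add: mult.assoc)
qed

text \<open>Rounding down loses less than 1, which is at most half of \<open>T / (4 * N)\<close>
  because \<open>8 * N \<le> T\<close>.\<close>

lemma dyadic_quotient_lower_bound:
  fixes T :: real
  assumes "0 < N" and "T \<le> 2 ^ l" and "8 * real N \<le> T"
  shows "T / (8 * real N) \<le> real (2 ^ l div (4 * N))"
proof -
  define M :: nat where "M = 2 ^ l div (4 * N)"
  have "2 ^ l < 4 * N + M * (4 * N)"
    using dividend_less_div_times[of "4 * N" "2 ^ l"] assms(1) by (simp add: M_def)
  then have "real (2 ^ l) < real (4 * N + M * (4 * N))" by (simp only: of_nat_less_iff)
  then have "2 ^ l < 4 * real N + real M * (4 * real N)" by simp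
  then have "T \<le> real M * (8 * real N)" using assms(2,3) by linarith
  then show ?thesis using assms(1) unfolding M_def[symmetric] by (simp add: divide_le_eq)
qed

text \<open>The argument for one fixed \<open>n\<close>, with all largeness conditions as
  hypotheses: they make \<open>l\<close> at least \<open>l0\<close>, the densities nonnegative, the
  family nonempty of size at least \<open>T / (8 * N)\<close>, and the likelihood term at most
  \<open>\<epsilon> / 2\<close>.\<close>

lemma coverage_le_expected_diameter_hoelder:
  assumes separated: "\<And>l r B. l0 \<le> l \<Longrightarrow> 1 \<le> B \<Longrightarrow> B * K * 2 powr (- real l * r) \<le> 1 \<Longrightarrow>
      \<exists>f :: nat \<Rightarrow> real \<Rightarrow> real.
        (\<forall>i<2 ^ l div (4 * N). f i \<in> hoelder_densities J0 \<Phi> \<Psi> r B \<and>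
           (LINT x:{0..1}|lborel. (f i x)\<^sup>2) = 1 + (B * 2 powr (- real l * (r + 1 / 2)))\<^sup>2) \<and>
        (\<forall>i<2 ^ l div (4 * N). \<forall>j<2 ^ l div (4 * N). i \<noteq> j \<longrightarrow>
           (\<exists>y\<in>{0..1}. B * \<eta> * 2 powr (- real l * r) \<le> \<bar>f i y - f j y\<bar>))"
    and pos: "0 < N" "0 < \<eta>" "0 < K" and B: "1 \<le> B" and r: "0 < r" and \<epsilon>: "0 < \<epsilon>" and n: "2 \<le> n"
    and T: "T = (8 * B\<^sup>2 * real n / ln (real n)) powr (1 / (2 * r + 1))"
    and large: "1 \<le> T" "2 ^ l0 \<le> T" "8 * real N \<le> T" "(B * K) powr (1 / r) \<le> T"
    and ratio: "real n powr (1 / 8) / T \<le> \<epsilon>\<^sup>2 / (8 * real N)"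
    and band: "confidence_band lo up"
    and honest: "asymptotically_honest \<alpha> (hoelder_densities J0 \<Phi> \<Psi> r B) lo up"
    and q: "\<And>f. f \<in> hoelder_densities J0 \<Phi> \<Psi> r B \<Longrightarrow>
      q \<le> emeasure (sample_law n f) (cover_event lo up n f)"
    and D: "\<And>f. f \<in> hoelder_densities J0 \<Phi> \<Psi> r B \<Longrightarrow>
      (\<integral>\<^sup>+ X. diameter_band lo up n X \<partial>sample_law n f) \<le> D"
    and s: "0 < s"
      "s \<le> \<eta> * (2 powr (- r) * 8 powr (- (r / (2 * r + 1))) * B powr (1 / (2 * r + 1)) * rate r n)"
  shows "q \<le> ennreal \<epsilon> + ennreal (1 / s) * D"
proof -
  obtain l :: nat where l: "T \<le> 2 ^ l" "2 ^ l \<le> 2 * T" using dyadic_between[OF large(1)] .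
  let ?M = "2 ^ l div (4 * N)"
  let ?d = "B * 2 powr (- real l * (r + 1 / 2))"
  note bounds = level_bounds[OF B r n, of l, folded T, OF l]
  have level: "l0 \<le> l"
  proof -
    have "(2 :: real) ^ l0 \<le> 2 ^ l" using large(2) l(1) by linarith
    then show ?thesis by simp
  qed
  have "B * K * 2 powr (- real l * r) \<le> 1"
  proof -
    have "B * K = ((B * K) powr (1 / r)) powr r" using B pos(3) r by (simp add: powr_powr)
    also have "\<dots> \<le> (2 ^ l) powr r" using large(4) l(1) r by (intro powr_mono2) auto
    finally show ?thesis unfolding powr_two_level by (simp add: powr_minus field_simps)
  qed
  from separated[OF level B this] obtain f :: "nat \<Rightarrow> real \<Rightarrow> real" where
    members: "\<forall>i<?M. f i \<in> hoelder_densities J0 \<Phi> \<Psi> r B \<and>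
      (LINT x:{0..1}|lborel. (f i x)\<^sup>2) = 1 + ?d\<^sup>2"
    and sep: "\<forall>i<?M. \<forall>j<?M. i \<noteq> j \<longrightarrow>
      (\<exists>y\<in>{0..1}. B * \<eta> * 2 powr (- real l * r) \<le> \<bar>f i y - f j y\<bar>)"
    by (elim exE conjE)
  have f: "f i \<in> hoelder_densities J0 \<Phi> \<Psi> r B"
    "(LINT x:{0..1}|lborel. (f i x)\<^sup>2) = 1 + ?d\<^sup>2" if "i < ?M" for i
    using members that by blast+
  have M: "T / (8 * real N) \<le> real ?M"
    by (rule dyadic_quotient_lower_bound[OF pos(1) l(1) large(3)])
  moreover have T_pos: "0 < T / (8 * real N)" using large(1) pos(1) by simp
  ultimately have M_pos: "0 < ?M" by (metis less_le_trans of_nat_0_less_iff)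
  have height: "s \<le> B * \<eta> * 2 powr (- real l * r)"
  proof -
    have "s \<le> \<eta> * (B * 2 powr (- real l * r))"
      using pos(2) by (intro order_trans[OF s(2)] mult_left_mono bounds(2)) auto
    then show ?thesis by (simp only: mult_ac)
  qed
  have "q \<le> ennreal (\<epsilon> / 2 + (1 + ?d\<^sup>2) ^ n / (2 * \<epsilon> * real (card {..<?M}))) + ennreal (1 / s) * D"
  proof (rule coverage_le_expected_diameter[where f = f and lo = lo and up = up])
    show "{..<?M} \<noteq> {}" using M_pos by auto
    show "\<exists>y\<in>{0..1}. s \<le> \<bar>f j y - f k y\<bar>" if "j \<in> {..<?M}" "k \<in> {..<?M}" "j \<noteq> k" for j k
      using sep that height by (meson lessThan_iff order_trans)
    show "diameter_band lo up n \<in> borel_measurable (sample_space n)"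
      using band by (simp add: confidence_band_def)
    show "cover_event lo up n (f k) \<in> sets (sample_space n)" if "k \<in> {..<?M}" for k
      using honest f(1)[of k] that by (simp add: asymptotically_honest_def)
  qed (use f q D s(1) \<epsilon> in \<open>auto simp: hoelder_densities_def\<close>)
  also have "(1 + ?d\<^sup>2) ^ n / (2 * \<epsilon> * real (card {..<?M})) \<le> \<epsilon> / 2"
  proof -
    have "(1 + ?d\<^sup>2) ^ n / real ?M \<le> real n powr (1 / 8) / (T / (8 * real N))"
      using bounds(1) M T_pos by (intro frac_le) auto
    also have "\<dots> \<le> \<epsilon>\<^sup>2" using ratio pos(1) by (simp add: field_simps)
    finally have "(1 + ?d\<^sup>2) ^ n / real ?M / (2 * \<epsilon>) \<le> \<epsilon>\<^sup>2 / (2 * \<epsilon>)"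
      using \<epsilon> by (intro divide_right_mono) auto
    then show ?thesis using \<epsilon> by (simp add: power2_eq_square mult_ac)
  qed
  then have "ennreal (\<epsilon> / 2 + (1 + ?d\<^sup>2) ^ n / (2 * \<epsilon> * real (card {..<?M}))) \<le> ennreal \<epsilon>"
    by (intro ennreal_leI) linarith
  finally show ?thesis by (simp add: add_right_mono)
qed

theorem proposition1:
  fixes S J0 :: nat
    and \<Phi> :: "nat \<Rightarrow> real \<Rightarrow> real" and \<Psi> :: "nat \<Rightarrow> nat \<Rightarrow> real \<Rightarrow> real"
    and r :: real
  assumes "daubechies_basis S J0 \<Phi> \<Psi>" and "0 < r" and "r < 1" and "r < real S"
  shows "\<exists>c p :: real. 0 < c \<and> 0 < p \<and>
    (\<forall>(B :: real) (\<alpha> :: real) (lo :: band) (up :: band).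
       1 \<le> B \<longrightarrow> 0 < \<alpha> \<longrightarrow> \<alpha> < 1 \<longrightarrow>
       confidence_band lo up \<longrightarrow>
       asymptotically_honest \<alpha> (hoelder_densities J0 \<Phi> \<Psi> r B) lo up \<longrightarrow>
       ennreal (c * B powr p * (1 - \<alpha>)) \<le>
         liminf (\<lambda>n. SUP f\<in>hoelder_densities J0 \<Phi> \<Psi> r B.
           (\<integral>\<^sup>+ X. diameter_band lo up n X \<partial>sample_law n f) / ennreal (rate r n)))"
proof -
  have "0 < S" using assms(2,4) by (cases S) auto
  obtain N :: nat and \<eta> K :: real and l0 :: nat where pos: "0 < N" "0 < \<eta>" "0 < K"
    and separated: "\<And>l r B. l0 \<le> l \<Longrightarrow> 1 \<le> B \<Longrightarrow> B * K * 2 powr (- real l * r) \<le> 1 \<Longrightarrow>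
      \<exists>f :: nat \<Rightarrow> real \<Rightarrow> real.
        (\<forall>i<2 ^ l div (4 * N). f i \<in> hoelder_densities J0 \<Phi> \<Psi> r B \<and>
           (LINT x:{0..1}|lborel. (f i x)\<^sup>2) = 1 + (B * 2 powr (- real l * (r + 1 / 2)))\<^sup>2) \<and>
        (\<forall>i<2 ^ l div (4 * N). \<forall>j<2 ^ l div (4 * N). i \<noteq> j \<longrightarrow>
           (\<exists>y\<in>{0..1}. B * \<eta> * 2 powr (- real l * r) \<le> \<bar>f i y - f j y\<bar>))"
    by (rule separated_hoelder_densities[OF assms(1) \<open>0 < S\<close>]) (rule that; assumption)
  \<comment> \<open>The product without the final \<open>/ 2\<close> is the constant in the
    separation of the densities. The factor \<open>1 / 2\<close> pays for the half of
    \<open>1 - \<alpha>\<close> that is given up below.\<close>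
  define c where "c = \<eta> * (2 powr (- r) * 8 powr (- (r / (2 * r + 1)))) / 2"
  define p where "p = 1 / (2 * r + 1)"
  show ?thesis
  proof (rule exI[of _ c], rule exI[of _ p], intro conjI allI impI)
    show "0 < c" using pos(2) by (simp add: c_def)
    show "0 < p" using assms(2) by (simp add: p_def)
    fix B \<alpha> :: real and lo up :: band
    assume B: "1 \<le> B" and \<alpha>: "0 < \<alpha>" "\<alpha> < 1" and band: "confidence_band lo up"
      and honest: "asymptotically_honest \<alpha> (hoelder_densities J0 \<Phi> \<Psi> r B) lo up"
    let ?\<Sigma> = "hoelder_densities J0 \<Phi> \<Psi> r B"
    define T where "T n = (8 * B\<^sup>2 * real n / ln (real n)) powr (1 / (2 * r + 1))" for n :: nat
    \<comment> \<open>Eventually the coverage exceeds \<open>3 * \<epsilon>\<close>; one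
      \<open>\<epsilon>\<close> goes to the likelihood term, and \<open>2 * \<epsilon>\<close>, half
      of \<open>1 - \<alpha>\<close>, remains for the diameter.\<close>
    define \<epsilon> where "\<epsilon> = (1 - \<alpha>) / 4"
    have \<epsilon>: "0 < \<epsilon>" "1 - \<alpha> = 4 * \<epsilon>" using \<alpha> by (auto simp: \<epsilon>_def)
    have C: "0 < 8 * B\<^sup>2" using B by simp
    have T_large: "\<forall>\<^sub>F n in sequentially. Z \<le> T n" for Z
      using level_scale_at_top[OF C assms(2)] unfolding T_def filterlim_at_top by blast
    have "0 < \<epsilon>\<^sup>2 / (8 * real N)" using \<epsilon>(1) pos(1) by simp
    from order_tendstoD(2)[OF eighth_root_dominated[OF C assms(2,3)] this]
    have ratio: "\<forall>\<^sub>F n in sequentially. real n powr (1 / 8) / T n < \<epsilon>\<^sup>2 / (8 * real N)"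
      unfolding T_def .
    \<comment> \<open>Strictness is essential: a liminf yields an eventual bound only for values
      strictly below it.\<close>
    have "ennreal (3 * \<epsilon>) < ennreal (1 - \<alpha>)" unfolding \<epsilon>(2) using \<epsilon>(1) by (intro ennreal_lessI) auto
    also have "\<dots> \<le> liminf (\<lambda>n. INF f\<in>?\<Sigma>. emeasure (sample_law n f) (cover_event lo up n f))"
      using honest by (simp add: asymptotically_honest_def)
    finally have cover: "\<forall>\<^sub>F n in sequentially.
        ennreal (3 * \<epsilon>) < (INF f\<in>?\<Sigma>. emeasure (sample_law n f) (cover_event lo up n f))"
      by (rule less_LiminfD)
    show "ennreal (c * B powr p * (1 - \<alpha>)) \<le>
         liminf (\<lambda>n. SUP f\<in>?\<Sigma>. (\<integral>\<^sup>+ X. diameter_band lo up n X \<partial>sample_law n f) / ennreal (rate r n))"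
    proof (rule Liminf_bounded)
      show "\<forall>\<^sub>F n in sequentially. ennreal (c * B powr p * (1 - \<alpha>)) \<le>
         (SUP f\<in>?\<Sigma>. (\<integral>\<^sup>+ X. diameter_band lo up n X \<partial>sample_law n f) / ennreal (rate r n))"
        using T_large[of 1] T_large[of "2 ^ l0"] T_large[of "8 * real N"] T_large[of "(B * K) powr (1 / r)"]
          ratio cover eventually_ge_at_top[of 2]
      proof eventually_elim
        case (elim n)
        let ?E = "\<lambda>f. \<integral>\<^sup>+ X. diameter_band lo up n X \<partial>sample_law n f"
        define R where "R = rate r n"
        define Q where "Q = (SUP f\<in>?\<Sigma>. ?E f / ennreal R)"
        define s where "s = 2 * c * B powr p * R"
        have R: "0 < R" using elim(7) by (simp add: R_def rate_def)
        have s: "0 < s" using pos(2) B R by (simp add: s_def c_def)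
        have "?E f \<le> Q * ennreal R" if "f \<in> ?\<Sigma>" for f
        proof -
          have "?E f = ?E f / ennreal R * ennreal R"
            using R by (simp add: ennreal_divide_times ennreal_divide_self)
          also have "\<dots> \<le> Q * ennreal R"
            unfolding Q_def using that by (intro mult_right_mono SUP_upper) auto
          finally show ?thesis .
        qed
        moreover have "ennreal (3 * \<epsilon>) \<le> emeasure (sample_law n f) (cover_event lo up n f)" if "f \<in> ?\<Sigma>" for f
          using elim(6) that by (meson INF_lower less_imp_le order_trans)
        ultimately have "ennreal (3 * \<epsilon>) \<le> ennreal \<epsilon> + ennreal (1 / s) * (Q * ennreal R)"
          using elim s
          by (intro coverage_le_expected_diameter_hoelder[OF separated pos B assms(2) \<epsilon>(1) _ T_def _ _ _ _ _ band honest])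
            (auto simp: s_def c_def p_def R_def)
        then have "ennreal (2 * \<epsilon>) + ennreal \<epsilon> \<le> ennreal (1 / s) * (Q * ennreal R) + ennreal \<epsilon>"
          using \<epsilon>(1) by (simp add: add.commute flip: ennreal_plus)
        \<comment> \<open>Only a finite term is cancelled, so \<open>Q\<close> may be
          infinite.\<close>
        then have "ennreal (2 * \<epsilon>) \<le> ennreal (1 / s) * (Q * ennreal R)"
          by (simp add: ennreal_add_left_cancel_le add.commute)
        then have "ennreal s * ennreal (2 * \<epsilon>) \<le> ennreal s * (ennreal (1 / s) * (Q * ennreal R))"
          by (intro mult_left_mono) auto
        also have "\<dots> = Q * ennreal R"
          using s by (simp add: mult.assoc[symmetric] flip: ennreal_mult)
        also have "ennreal s * ennreal (2 * \<epsilon>) = ennreal R * ennreal (c * B powr p * (1 - \<alpha>))"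
          using s R \<epsilon> \<open>0 < c\<close> by (simp add: s_def mult_ac flip: ennreal_mult)
        finally have "ennreal R * ennreal (c * B powr p * (1 - \<alpha>)) \<le> ennreal R * Q"
          by (simp add: mult.commute)
        then show ?case
          using R by (simp add: ennreal_mult_le_mult_iff Q_def R_def)
      qed
    qed
  qed
qed

end
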